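(* If $(\nabla,\mathbb E)$ is a radiant structure on a compact manifold then there is no $\nabla$-parallel volume form and a $\nabla$-parallel one-form is identically zero.
   Context: Manifolds are smooth, connected, without boundary. A radiant structure on a manifold is a pair $(\nabla,\mathbb E)$ comprising a torsion-free affine connection $\nabla$ and a vector field $\mathbb E$ such that $\nabla_X\mathbb E=X$ for all vector fields $X$. A volume form on an $n$-manifold is a nowhere-vanishing $n$-form. *)

theory Defs
  imports "HOL-Analysis.Analysis"
begin

text \<open>
  All objects live on a type \<open>'m\<close> that is Hausdorff and second countable by its sort; the
  manifold is the whole type. It is modelled on a Euclidean space \<open>'e\<close>, so its dimension
  is \<open>DIM('e)\<close>, which is at least 1.
\<close>

section \<open>Smooth maps between Euclidean spaces\<close>

text \<open>Only used for open sets \<open>S\<close>, where \<^term>\<open>at x\<close> sees nothing outside \<open>S\<close>.\<close>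

primrec Ck_on ::
  "nat \<Rightarrow> 'a::euclidean_space set \<Rightarrow> ('a \<Rightarrow> 'b::real_normed_vector) \<Rightarrow> bool" where
  "Ck_on 0 S f \<longleftrightarrow> continuous_on S f"
| "Ck_on (Suc k) S f \<longleftrightarrow>
     (\<forall>x\<in>S. f differentiable (at x)) \<and>
     (\<forall>v. Ck_on k S (\<lambda>x. frechet_derivative f (at x) v))"

definition smooth_on ::
  "'a::euclidean_space set \<Rightarrow> ('a \<Rightarrow> 'b::real_normed_vector) \<Rightarrow> bool" where
  "smooth_on S f \<longleftrightarrow> (\<forall>k. Ck_on k S f)"

section \<open>Smooth manifolds\<close>

type_synonym ('m, 'e) chart = "'m set \<times> ('m \<Rightarrow> 'e)"

definition is_chart :: "('m::topological_space, 'e::euclidean_space) chart \<Rightarrow> bool" where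
  "is_chart c \<longleftrightarrow> (case c of (U, \<phi>) \<Rightarrow>
     open U \<and> open (\<phi> ` U) \<and> homeomorphism U (\<phi> ` U) \<phi> (inv_into U \<phi>))"

text \<open>Only one of the two transition maps is constrained here; the other one is obtained by
  exchanging the two charts.\<close>

definition smooth_transition ::
  "('m::topological_space, 'e::euclidean_space) chart \<Rightarrow> ('m, 'e) chart \<Rightarrow> bool" where
  "smooth_transition c d \<longleftrightarrow> (case (c, d) of ((U, \<phi>), (V, \<psi>)) \<Rightarrow>
     smooth_on (\<phi> ` (U \<inter> V)) (\<psi> \<circ> inv_into U \<phi>))"

text \<open>The smooth structure is given by an arbitrary, not necessarily maximal, smooth atlas.\<close>

definition smooth_manifold ::
  "('m::{t2_space,second_countable_topology}, 'e::euclidean_space) chart set \<Rightarrow> bool" where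
  "smooth_manifold A \<longleftrightarrow>
     (\<forall>c\<in>A. is_chart c) \<and>
     (\<Union>c\<in>A. fst c) = UNIV \<and>
     (\<forall>c\<in>A. \<forall>d\<in>A. smooth_transition c d) \<and>
     connected (UNIV :: 'm set)"

definition smooth_fun ::
  "('m::topological_space, 'e::euclidean_space) chart set \<Rightarrow> ('m \<Rightarrow> real) \<Rightarrow> bool" where
  "smooth_fun A f \<longleftrightarrow> (\<forall>(U, \<phi>)\<in>A. smooth_on (\<phi> ` U) (f \<circ> inv_into U \<phi>))"

section \<open>Tangent vectors and vector fields\<close>

type_synonym 'm tvec = "('m \<Rightarrow> real) \<Rightarrow> real"
type_synonym 'm vfield = "'m \<Rightarrow> 'm tvec"

text \<open>Tangent vectors at \<open>p\<close> are the derivations at \<open>p\<close> of the algebra of smooth functions.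
  As functions are total in HOL, they are extended by 0 to non-smooth functions; with this
  convention equality of tangent vectors and of vector fields is plain equality.\<close>

definition tangent_space ::
  "('m::topological_space, 'e::euclidean_space) chart set \<Rightarrow> 'm \<Rightarrow> 'm tvec set" where
  "tangent_space A p = {v.
     (\<forall>f g a b. smooth_fun A f \<longrightarrow> smooth_fun A g \<longrightarrow>
        v (\<lambda>q. a * f q + b * g q) = a * v f + b * v g) \<and>
     (\<forall>f g. smooth_fun A f \<longrightarrow> smooth_fun A g \<longrightarrow>
        v (\<lambda>q. f q * g q) = f p * v g + g p * v f) \<and>
     (\<forall>f. \<not> smooth_fun A f \<longrightarrow> v f = 0)}"

definition vector_fields ::
  "('m::topological_space, 'e::euclidean_space) chart set \<Rightarrow> 'm vfield set" where
  "vector_fields A = {X.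
     (\<forall>p. X p \<in> tangent_space A p) \<and>
     (\<forall>f. smooth_fun A f \<longrightarrow> smooth_fun A (\<lambda>p. X p f))}"

definition vf_add :: "'m vfield \<Rightarrow> 'm vfield \<Rightarrow> 'm vfield" where
  "vf_add X Y = (\<lambda>p f. X p f + Y p f)"

definition vf_diff :: "'m vfield \<Rightarrow> 'm vfield \<Rightarrow> 'm vfield" where
  "vf_diff X Y = (\<lambda>p f. X p f - Y p f)"

definition vf_scale :: "('m \<Rightarrow> real) \<Rightarrow> 'm vfield \<Rightarrow> 'm vfield" where
  "vf_scale h X = (\<lambda>p f. h p * X p f)"

definition lie_bracket :: "'m vfield \<Rightarrow> 'm vfield \<Rightarrow> 'm vfield" where
  "lie_bracket X Y = (\<lambda>p f. X p (\<lambda>q. Y q f) - Y p (\<lambda>q. X q f))"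

section \<open>Affine connections and radiant structures\<close>

text \<open>Linearity over the reals in the second argument is the Leibniz rule for constant \<open>h\<close>,
  together with additivity.\<close>

definition affine_connection ::
  "('m::topological_space, 'e::euclidean_space) chart set \<Rightarrow>
   ('m vfield \<Rightarrow> 'm vfield \<Rightarrow> 'm vfield) \<Rightarrow> bool" where
  "affine_connection A nabla \<longleftrightarrow>
     (\<forall>X\<in>vector_fields A. \<forall>Y\<in>vector_fields A. nabla X Y \<in> vector_fields A) \<and>
     (\<forall>X\<in>vector_fields A. \<forall>X'\<in>vector_fields A. \<forall>Y\<in>vector_fields A.
        nabla (vf_add X X') Y = vf_add (nabla X Y) (nabla X' Y)) \<and>
     (\<forall>h. \<forall>X\<in>vector_fields A. \<forall>Y\<in>vector_fields A. smooth_fun A h \<longrightarrow>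
        nabla (vf_scale h X) Y = vf_scale h (nabla X Y)) \<and>
     (\<forall>X\<in>vector_fields A. \<forall>Y\<in>vector_fields A. \<forall>Y'\<in>vector_fields A.
        nabla X (vf_add Y Y') = vf_add (nabla X Y) (nabla X Y')) \<and>
     (\<forall>h. \<forall>X\<in>vector_fields A. \<forall>Y\<in>vector_fields A. smooth_fun A h \<longrightarrow>
        nabla X (vf_scale h Y) = vf_add (vf_scale (\<lambda>p. X p h) Y) (vf_scale h (nabla X Y)))"

definition torsion_free ::
  "('m::topological_space, 'e::euclidean_space) chart set \<Rightarrow>
   ('m vfield \<Rightarrow> 'm vfield \<Rightarrow> 'm vfield) \<Rightarrow> bool" where
  "torsion_free A nabla \<longleftrightarrow>
     (\<forall>X\<in>vector_fields A. \<forall>Y\<in>vector_fields A.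
        vf_diff (nabla X Y) (nabla Y X) = lie_bracket X Y)"

definition radiant_structure ::
  "('m::topological_space, 'e::euclidean_space) chart set \<Rightarrow>
   ('m vfield \<Rightarrow> 'm vfield \<Rightarrow> 'm vfield) \<Rightarrow> 'm vfield \<Rightarrow> bool" where
  "radiant_structure A nabla E \<longleftrightarrow>
     affine_connection A nabla \<and> torsion_free A nabla \<and>
     E \<in> vector_fields A \<and> (\<forall>X\<in>vector_fields A. nabla X E = X)"

section \<open>Differential forms\<close>

text \<open>A \<open>k\<close>-form assigns to each point \<open>p\<close> a function on lists of tangent vectors. Only its
  values on lists of length \<open>k\<close> of elements of the tangent space at \<open>p\<close> are meaningful.\<close>

type_synonym 'm form = "'m \<Rightarrow> 'm tvec list \<Rightarrow> real"

definition alternating_multilinear :: "nat \<Rightarrow> 'm tvec set \<Rightarrow> ('m tvec list \<Rightarrow> real) \<Rightarrow> bool" where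
  "alternating_multilinear k V L \<longleftrightarrow>
     (\<forall>vs i u w a b. vs \<in> lists V \<longrightarrow> length vs = k \<longrightarrow> i < k \<longrightarrow> u \<in> V \<longrightarrow> w \<in> V \<longrightarrow>
        L (vs[i := (\<lambda>f. a * u f + b * w f)]) = a * L (vs[i := u]) + b * L (vs[i := w])) \<and>
     (\<forall>vs i j. vs \<in> lists V \<longrightarrow> length vs = k \<longrightarrow> i < j \<longrightarrow> j < k \<longrightarrow> vs ! i = vs ! j \<longrightarrow>
        L vs = 0)"

definition form_eval :: "'m form \<Rightarrow> 'm vfield list \<Rightarrow> 'm \<Rightarrow> real" where
  "form_eval \<omega> Xs = (\<lambda>p. \<omega> p (map (\<lambda>X. X p) Xs))"

definition diff_form ::
  "('m::topological_space, 'e::euclidean_space) chart set \<Rightarrow> nat \<Rightarrow> 'm form \<Rightarrow> bool" where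
  "diff_form A k \<omega> \<longleftrightarrow>
     (\<forall>p. alternating_multilinear k (tangent_space A p) (\<omega> p)) \<and>
     (\<forall>Xs \<in> lists (vector_fields A). length Xs = k \<longrightarrow> smooth_fun A (form_eval \<omega> Xs))"

definition volume_form ::
  "('m::topological_space, 'e::euclidean_space) chart set \<Rightarrow> 'm form \<Rightarrow> bool" where
  "volume_form A \<omega> \<longleftrightarrow>
     diff_form A DIM('e) \<omega> \<and>
     (\<forall>p. \<exists>vs \<in> lists (tangent_space A p). length vs = DIM('e) \<and> \<omega> p vs \<noteq> 0)"

text \<open>\<open>(\<nabla>\<^sub>X \<omega>)(Y\<^sub>1, \<dots>, Y\<^sub>k)\<close> is
  \<open>X (\<omega>(Y\<^sub>1, \<dots>, Y\<^sub>k)) - \<Sum>i. \<omega>(Y\<^sub>1, \<dots>, \<nabla>\<^sub>X Y\<^sub>i, \<dots>, Y\<^sub>k)\<close>.\<close>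

definition cov_deriv_form ::
  "('m vfield \<Rightarrow> 'm vfield \<Rightarrow> 'm vfield) \<Rightarrow> 'm vfield \<Rightarrow> 'm form \<Rightarrow> 'm vfield list \<Rightarrow> 'm \<Rightarrow> real"
  where
  "cov_deriv_form nabla X \<omega> Ys = (\<lambda>p.
     X p (form_eval \<omega> Ys) -
     (\<Sum>i<length Ys. form_eval \<omega> (Ys[i := nabla X (Ys ! i)]) p))"

definition parallel_form ::
  "('m::topological_space, 'e::euclidean_space) chart set \<Rightarrow>
   ('m vfield \<Rightarrow> 'm vfield \<Rightarrow> 'm vfield) \<Rightarrow> nat \<Rightarrow> 'm form \<Rightarrow> bool" where
  "parallel_form A nabla k \<omega> \<longleftrightarrow>
     (\<forall>X \<in> vector_fields A. \<forall>Ys \<in> lists (vector_fields A). length Ys = k \<longrightarrow>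
        (\<forall>p. cov_deriv_form nabla X \<omega> Ys p = 0))"

definition form_is_zero ::
  "('m::topological_space, 'e::euclidean_space) chart set \<Rightarrow> nat \<Rightarrow> 'm form \<Rightarrow> bool" where
  "form_is_zero A k \<omega> \<longleftrightarrow>
     (\<forall>p. \<forall>vs \<in> lists (tangent_space A p). length vs = k \<longrightarrow> \<omega> p vs = 0)"

end

theory Submission
  imports Defs
begin

text \<open>
  A parallel one-form \<open>\<alpha>\<close> satisfies \<open>\<alpha> = df\<close> for \<open>f = \<alpha>(E)\<close>, because \<open>X f = \<alpha>(\<nabla>\<^sub>X E) = \<alpha>(X)\<close>.
  Hence \<open>E f = f\<close>, so \<open>f\<close> vanishes at its maximum and at its minimum, and \<open>\<alpha> = df = 0\<close>.

  For a parallel volume form \<open>\<omega>\<close>, torsion-freeness gives \<open>\<nabla>\<^sub>E X = X + [E, X]\<close>, so in coordinates the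
  divergence of \<open>E\<close> with respect to \<open>\<omega>\<close> is the dimension \<open>n\<close>. Integrating \<open>div (\<rho> E) = E \<rho> + n \<rho>\<close>
  against the density of \<open>\<omega>\<close> for each member \<open>\<rho>\<close> of a partition of unity and summing gives
  \<open>n vol(M) = 0\<close>.
\<close>

section \<open>Calculus of smooth maps\<close>

text \<open>Smooth functions and vector fields live on the whole manifold, tangent vectors
  differentiate global functions, and \<open>nabla\<close> accepts global fields only, so a
  coordinate frame on an open set is no admissible argument. The remedy is the
  \<open>coordinate_ball\<close>: global fields \<open>X i\<close> and global functions
  \<open>x i\<close>, cut off away from a ball on which they are the coordinate frame and the
  coordinates. Local formulas are proved at points of that ball. The i-th component of nabla_E X_i
  is 1 - X_i(E x_i). Parallelism sees only the sum of these components: the ones add up to n, and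
  the terms X_i(E x_i) cancel against those of the Euclidean divergence. No measure on the manifold
  is built. Each ball has its own integral against the absolute value of the coefficient of the
  form, and two of them agree on functions supported in both balls, by change of variables. Using
  the partition of unity twice replaces a global integral: multiplying the i-th divergence by the
  j-th member moves it from the i-th integral to the j-th.\<close>

lemma frechet_derivative_eq:
  "(f has_derivative f') (at x) \<Longrightarrow> frechet_derivative f (at x) = f'"
  by (rule frechet_derivative_at [symmetric])

lemma Ck_on_cong:
  assumes "open S" "\<And>x. x \<in> S \<Longrightarrow> f x = g x" "Ck_on k S f"
  shows "Ck_on k S g"
  using assms(2,3)
proof (induction k arbitrary: f g)
  case 0
  then show ?case by (simp cong: continuous_on_cong)
next
  case (Suc k)
  have d: "(g has_derivative frechet_derivative f (at x)) (at x)" if "x \<in> S" for x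
    using Suc.prems that assms(1)
    by (intro has_derivative_transform_within_open[of f _ x UNIV S g])
       (auto simp: frechet_derivative_works)
  have "Ck_on k S (\<lambda>x. frechet_derivative g (at x) v)" for v
    by (rule Suc.IH[of "\<lambda>x. frechet_derivative f (at x) v"])
       (use Suc.prems in \<open>auto simp: frechet_derivative_eq[OF d]\<close>)
  then show ?case using d by (auto simp: differentiable_def)
qed

lemma Ck_on_Suc_D: "Ck_on (Suc k) S f \<Longrightarrow> Ck_on k S f"
proof (induction k arbitrary: f)
  case 0
  then show ?case
    by (auto intro!: continuous_at_imp_continuous_on differentiable_imp_continuous_within)
next
  case (Suc k)
  then show ?case by (metis Ck_on.simps(2))
qed

lemma Ck_on_continuous: "Ck_on k S f \<Longrightarrow> continuous_on S f"
  by (induction k) (auto dest: Ck_on_Suc_D simp del: Ck_on.simps(2))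

lemma Ck_on_local:
  assumes "\<And>x. x \<in> S \<Longrightarrow> \<exists>T. open T \<and> x \<in> T \<and> Ck_on k T f"
  shows "Ck_on k S f"
  using assms
proof (induction k arbitrary: f)
  case 0
  show ?case
    unfolding Ck_on.simps
  proof (rule continuous_at_imp_continuous_on, rule ballI)
    fix x assume "x \<in> S"
    with 0 obtain T where "open T" "x \<in> T" "continuous_on T f" by force
    then show "isCont f x" by (simp add: continuous_on_eq_continuous_at)
  qed
next
  case (Suc k)
  have "Ck_on k S (\<lambda>x. frechet_derivative f (at x) v)" for v
    by (rule Suc.IH) (use Suc.prems in fastforce)
  then show ?case using Suc.prems by fastforce
qed

lemma Ck_on_subset: "Ck_on k S f \<Longrightarrow> T \<subseteq> S \<Longrightarrow> Ck_on k T f"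
  by (induction k arbitrary: f) (auto intro: continuous_on_subset)

text \<open>Trades the choice operator \<open>frechet_derivative\<close> in the definition for any
  explicit derivative; the closure rules below rest on this.\<close>

lemma Ck_on_Suc_I:
  assumes "open S" "\<And>x. x \<in> S \<Longrightarrow> (f has_derivative f' x) (at x)"
    "\<And>v. Ck_on k S (\<lambda>x. f' x v)"
  shows "Ck_on (Suc k) S f"
proof -
  have "Ck_on k S (\<lambda>x. frechet_derivative f (at x) v)" for v
    by (rule Ck_on_cong[OF assms(1) _ assms(3)[of v]]) (metis assms(2) frechet_derivative_eq)
  then show ?thesis using assms(2) by (auto simp: differentiable_def)
qed

lemma Ck_on_has_derivative:
  "Ck_on (Suc k) S f \<Longrightarrow> x \<in> S \<Longrightarrow> (f has_derivative frechet_derivative f (at x)) (at x)"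
  by (auto simp: frechet_derivative_works)

lemma Ck_on_const: "open S \<Longrightarrow> Ck_on k S (\<lambda>x. c)"
  by (induction k arbitrary: c) (auto simp del: Ck_on.simps(2) intro!: Ck_on_Suc_I derivative_eq_intros)

lemma Ck_on_add:
  "open S \<Longrightarrow> Ck_on k S f \<Longrightarrow> Ck_on k S g \<Longrightarrow> Ck_on k S (\<lambda>x. f x + g x)"
proof (induction k arbitrary: f g)
  case (Suc k)
  show ?case
    by (rule Ck_on_Suc_I[OF Suc.prems(1) has_derivative_add])
       (use Suc.prems Suc.IH in \<open>auto simp: frechet_derivative_works\<close>)
qed (auto intro: continuous_intros)

lemma Ck_on_sum:
  "open S \<Longrightarrow> (\<And>i. i \<in> I \<Longrightarrow> Ck_on k S (f i)) \<Longrightarrow> Ck_on k S (\<lambda>x. \<Sum>i\<in>I. f i x)"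
  by (induction I rule: infinite_finite_induct) (auto intro: Ck_on_add Ck_on_const)

lemma Ck_on_scaleR:
  fixes f :: "'a::euclidean_space \<Rightarrow> real"
  shows "open S \<Longrightarrow> Ck_on k S f \<Longrightarrow> Ck_on k S g \<Longrightarrow> Ck_on k S (\<lambda>x. f x *\<^sub>R g x)"
proof (induction k arbitrary: f g)
  case (Suc k)
  show ?case
    by (rule Ck_on_Suc_I[OF Suc.prems(1) has_derivative_scaleR])
       (use Suc.prems Suc.IH Ck_on_Suc_D[OF Suc.prems(2)] Ck_on_Suc_D[OF Suc.prems(3)]
        in \<open>auto simp: frechet_derivative_works intro!: Ck_on_add\<close>)
qed (auto intro: continuous_intros)

lemma Ck_on_linear:
  assumes "bounded_linear L" "open S" "Ck_on k S f"
  shows "Ck_on k S (\<lambda>x. L (f x))"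
  using assms(3)
proof (induction k arbitrary: f)
  case 0
  then show ?case using assms(1) by (auto intro: bounded_linear.continuous_on)
next
  case (Suc k)
  show ?case
    by (rule Ck_on_Suc_I[OF assms(2) bounded_linear.has_derivative[OF assms(1)]])
       (use Suc in \<open>auto simp: frechet_derivative_works\<close>)
qed

lemma Ck_on_ident: "open S \<Longrightarrow> Ck_on k S (\<lambda>x. x)"
proof (cases k)
  case (Suc m)
  show "open S \<Longrightarrow> ?thesis" unfolding Suc
    by (rule Ck_on_Suc_I[where f'="\<lambda>x v. v"]) (auto intro: Ck_on_const)
qed (auto intro: continuous_intros)

lemma linear_sum_Basis:
  fixes L :: "'a::euclidean_space \<Rightarrow> 'b::real_vector"
  assumes "linear L" shows "L w = (\<Sum>b\<in>Basis. (w \<bullet> b) *\<^sub>R L b)"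
  by (subst (1) euclidean_representation[of w, symmetric])
     (simp add: linear_sum[OF assms] linear_scale[OF assms])

text \<open>\<open>Ck_on\<close> tests derivatives in fixed directions, whereas the chain rule
  differentiates f in the direction g'(x) v, which moves with x. Expanding that direction over
  \<open>Basis\<close> leaves products of C^k coefficients with f'(g x) b for fixed b, to which the
  induction hypothesis applies.\<close>

lemma Ck_on_compose:
  fixes g :: "'a::euclidean_space \<Rightarrow> 'b::euclidean_space"
  assumes "open S" "open T" "g ` S \<subseteq> T" "Ck_on k T f" "Ck_on k S g"
  shows "Ck_on k S (\<lambda>x. f (g x))"
  using assms(4,5)
proof (induction k arbitrary: f)
  case 0
  then show ?case using assms(3) by (auto intro: continuous_on_compose2)
next
  case (Suc k)
  have f: "(f has_derivative frechet_derivative f (at (g x))) (at (g x))" if "x \<in> S" for x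
    using Suc.prems that assms(3) by (auto simp: frechet_derivative_works)
  have g: "(g has_derivative frechet_derivative g (at x)) (at x)" if "x \<in> S" for x
    using Suc.prems that by (auto simp: frechet_derivative_works)
  have lin: "linear (frechet_derivative f (at (g x)))" if "x \<in> S" for x
    using f[OF that] by (simp add: has_derivative_linear)
  show ?case
  proof (rule Ck_on_Suc_I[OF assms(1)])
    fix x assume x: "x \<in> S"
    show "((\<lambda>x. f (g x)) has_derivative (\<lambda>v. \<Sum>b\<in>Basis.
        (frechet_derivative g (at x) v \<bullet> b) *\<^sub>R frechet_derivative f (at (g x)) b)) (at x)"
      using has_derivative_compose[OF g[OF x] f[OF x]]
      by (simp add: linear_sum_Basis[OF lin[OF x], symmetric])
  next
    fix v
    show "Ck_on k S (\<lambda>x. \<Sum>b\<in>Basis.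
        (frechet_derivative g (at x) v \<bullet> b) *\<^sub>R frechet_derivative f (at (g x)) b)"
      using Suc.prems
      by (intro Ck_on_sum Ck_on_scaleR Ck_on_linear[OF bounded_linear_inner_left] assms(1) Suc.IH)
         (auto simp del: Ck_on.simps(2) dest: Ck_on_Suc_D, auto)
  qed
qed

text \<open>The derivative of 1/f is a product of f' with 1/f itself, which is one order less smooth
  and so covered by the induction.\<close>

lemma Ck_on_inverse:
  fixes f :: "'a::euclidean_space \<Rightarrow> real"
  assumes "open S" "\<And>x. x \<in> S \<Longrightarrow> f x \<noteq> 0" "Ck_on k S f"
  shows "Ck_on k S (\<lambda>x. inverse (f x))"
  using assms(3)
proof (induction k)
  case 0
  then show ?case using assms(2) by (auto intro: continuous_intros)
next
  case (Suc k)
  note IH = Suc.IH[OF Ck_on_Suc_D[OF Suc.prems]]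
  show ?case
  proof (rule Ck_on_Suc_I[OF assms(1)])
    fix x assume x: "x \<in> S"
    show "((\<lambda>x. inverse (f x)) has_derivative
      (\<lambda>v. - (inverse (f x) *\<^sub>R (inverse (f x) *\<^sub>R frechet_derivative f (at x) v)))) (at x)"
      using Deriv.has_derivative_inverse[OF assms(2)[OF x] Ck_on_has_derivative[OF Suc.prems x]]
      by (simp add: algebra_simps)
  next
    fix v
    show "Ck_on k S (\<lambda>x. - (inverse (f x) *\<^sub>R (inverse (f x) *\<^sub>R frechet_derivative f (at x) v)))"
      using Suc.prems
      by (intro Ck_on_linear[OF bounded_linear_minus[OF bounded_linear_ident]] Ck_on_scaleR IH assms(1)) auto
  qed
qed

lemma smooth_on_cong:
  "open S \<Longrightarrow> (\<And>x. x \<in> S \<Longrightarrow> f x = g x) \<Longrightarrow> smooth_on S f \<Longrightarrow> smooth_on S g"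
  unfolding smooth_on_def by (blast intro: Ck_on_cong)

lemma smooth_on_local:
  "(\<And>x. x \<in> S \<Longrightarrow> \<exists>T. open T \<and> x \<in> T \<and> smooth_on T f) \<Longrightarrow> smooth_on S f"
  unfolding smooth_on_def by (metis Ck_on_local)

lemma smooth_on_subset: "smooth_on S f \<Longrightarrow> T \<subseteq> S \<Longrightarrow> smooth_on T f"
  unfolding smooth_on_def by (blast intro: Ck_on_subset)

lemma smooth_on_const [simp]: "open S \<Longrightarrow> smooth_on S (\<lambda>x. c)"
  unfolding smooth_on_def by (blast intro: Ck_on_const)

lemma smooth_on_ident: "open S \<Longrightarrow> smooth_on S (\<lambda>x. x)"
  unfolding smooth_on_def by (blast intro: Ck_on_ident)

lemma smooth_on_add:
  "open S \<Longrightarrow> smooth_on S f \<Longrightarrow> smooth_on S g \<Longrightarrow> smooth_on S (\<lambda>x. f x + g x)"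
  unfolding smooth_on_def by (blast intro: Ck_on_add)

lemma smooth_on_sum:
  "open S \<Longrightarrow> (\<And>i. i \<in> I \<Longrightarrow> smooth_on S (f i)) \<Longrightarrow> smooth_on S (\<lambda>x. \<Sum>i\<in>I. f i x)"
  unfolding smooth_on_def by (blast intro: Ck_on_sum)

lemma smooth_on_scaleR:
  "open S \<Longrightarrow> smooth_on S f \<Longrightarrow> smooth_on S g \<Longrightarrow> smooth_on S (\<lambda>x. f x *\<^sub>R g x)"
  unfolding smooth_on_def by (blast intro: Ck_on_scaleR)

lemma smooth_on_mult:
  fixes f g :: "'a::euclidean_space \<Rightarrow> real"
  shows "open S \<Longrightarrow> smooth_on S f \<Longrightarrow> smooth_on S g \<Longrightarrow> smooth_on S (\<lambda>x. f x * g x)"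
  using smooth_on_scaleR[of S f g] by simp

lemma smooth_on_linear:
  "bounded_linear L \<Longrightarrow> open S \<Longrightarrow> smooth_on S f \<Longrightarrow> smooth_on S (\<lambda>x. L (f x))"
  unfolding smooth_on_def by (blast intro: Ck_on_linear)

lemma smooth_on_compose:
  fixes g :: "'a::euclidean_space \<Rightarrow> 'b::euclidean_space"
  shows "open S \<Longrightarrow> open T \<Longrightarrow> g ` S \<subseteq> T \<Longrightarrow> smooth_on T f \<Longrightarrow> smooth_on S g \<Longrightarrow>
    smooth_on S (\<lambda>x. f (g x))"
  unfolding smooth_on_def by (blast intro: Ck_on_compose)

lemma smooth_on_inverse:
  fixes f :: "'a::euclidean_space \<Rightarrow> real"
  shows "open S \<Longrightarrow> (\<And>x. x \<in> S \<Longrightarrow> f x \<noteq> 0) \<Longrightarrow> smooth_on S f \<Longrightarrow> smooth_on S (\<lambda>x. inverse (f x))"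
  unfolding smooth_on_def by (blast intro: Ck_on_inverse)

lemma smooth_on_continuous: "smooth_on S f \<Longrightarrow> continuous_on S f"
  unfolding smooth_on_def using Ck_on_continuous by blast

lemma smooth_on_has_derivative:
  "smooth_on S f \<Longrightarrow> x \<in> S \<Longrightarrow> (f has_derivative frechet_derivative f (at x)) (at x)"
  unfolding smooth_on_def by (metis Ck_on_has_derivative)

lemma smooth_on_frechet_derivative:
  "smooth_on S f \<Longrightarrow> smooth_on S (\<lambda>x. frechet_derivative f (at x) v)"
  unfolding smooth_on_def by (metis Ck_on.simps(2))

section \<open>Hadamard's lemma and bump functions\<close>

lemma segment_mem:
  fixes a :: "'a::real_vector"
  assumes "convex S" "a \<in> S" "y \<in> S" "t \<in> {0..1::real}"
  shows "a + t *\<^sub>R (y - a) \<in> S"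
  using convexD_alt[OF assms(1-3), of t] assms(4) by (simp add: algebra_simps)

text \<open>Differentiating under the integral sign turns H into a directional derivative of H and
  produces one more factor t. The power \<open>t ^ m\<close> makes the family of such integrals
  closed under differentiation, which is what the induction on k needs.\<close>

lemma Ck_on_segment_integral:
  fixes H :: "'a::euclidean_space \<Rightarrow> real"
  assumes "open S" "convex S" "a \<in> S" "smooth_on S H"
  shows "Ck_on k S (\<lambda>y. integral {0..1} (\<lambda>t. t ^ m * H (a + t *\<^sub>R (y - a))))"
  using assms(4)
proof (induction k arbitrary: H m)
  case (0 H m)
  have c: "continuous_on (S \<times> cbox 0 1) (\<lambda>(y, t). t ^ m * H (a + t *\<^sub>R (y - a)))"
    unfolding split_beta
    by (intro continuous_intros continuous_on_compose2[OF smooth_on_continuous[OF 0]])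
       (use segment_mem[OF assms(2,3)] in auto)
  show ?case
    using integral_continuous_on_param[OF c] by simp
next
  case (Suc k H m)
  let ?H' = "\<lambda>z. frechet_derivative H (at z)"
  have H': "(H has_derivative ?H' z) (at z)" if "z \<in> S" for z
    using smooth_on_has_derivative[OF Suc.prems that] .
  have bl: "bounded_linear (?H' z)" if "z \<in> S" for z
    using H'[OF that] by (rule has_derivative_bounded_linear)
  have seg: "a + t *\<^sub>R (y - a) \<in> S" if "y \<in> S" "t \<in> cbox 0 1" for y t
    using segment_mem[OF assms(2,3)] that by simp
  \<comment> \<open>The Leibniz rule takes the y-derivative of the integrand as a continuous family
    of bounded linear maps. Continuity of that family is then checked on basis vectors.\<close>
  define fx where "fx y t = Blinfun (\<lambda>v. t ^ Suc m * ?H' (a + t *\<^sub>R (y - a)) v)" for y t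
  have fx: "blinfun_apply (fx y t) = (\<lambda>v. t ^ Suc m * ?H' (a + t *\<^sub>R (y - a)) v)"
    if "y \<in> S" "t \<in> cbox 0 1" for y t
    unfolding fx_def
    by (rule bounded_linear_Blinfun_apply)
       (intro bounded_linear_const_mult bl seg that)
  have cont: "continuous_on (S \<times> cbox 0 1) (\<lambda>(y, t). fx y t)"
  proof (rule continuous_on_blinfun_componentwise)
    fix i :: 'a assume "i \<in> Basis"
    have "continuous_on (S \<times> cbox 0 1) (\<lambda>(y, t). t ^ Suc m * ?H' (a + t *\<^sub>R (y - a)) i)"
      unfolding split_beta
      by (intro continuous_intros continuous_on_compose2[OF smooth_on_continuous[OF
            smooth_on_frechet_derivative[OF Suc.prems]]])
         (use seg in auto)
    then show "continuous_on (S \<times> cbox 0 1) (\<lambda>x. blinfun_apply (case x of (y, t) \<Rightarrow> fx y t) i)"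
      by (rule continuous_on_eq) (auto simp: fx)
  qed
  have der: "((\<lambda>y. integral (cbox 0 1) (\<lambda>t. t ^ m * H (a + t *\<^sub>R (y - a)))) has_derivative
      blinfun_apply (integral (cbox 0 1) (fx x))) (at x)" if x: "x \<in> S" for x
  proof -
    have "((\<lambda>y. integral (cbox 0 1) (\<lambda>t. t ^ m * H (a + t *\<^sub>R (y - a)))) has_derivative
      blinfun_apply (integral (cbox 0 1) (fx x))) (at x within S)"
    proof (rule leibniz_rule[OF _ _ cont x assms(2)])
      fix y t assume yt: "y \<in> S" "t \<in> cbox 0 (1::real)"
      have "((\<lambda>y. a + t *\<^sub>R (y - a)) has_derivative (\<lambda>v. t *\<^sub>R v)) (at y within S)"
        by (auto intro!: derivative_eq_intros simp: algebra_simps)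
      from has_derivative_compose[OF this H'[OF seg[OF yt]]]
      have "((\<lambda>y. H (a + t *\<^sub>R (y - a))) has_derivative
          (\<lambda>v. ?H' (a + t *\<^sub>R (y - a)) (t *\<^sub>R v))) (at y within S)" .
      from has_derivative_mult_right[OF this, of "t ^ m"]
      show "((\<lambda>y. t ^ m * H (a + t *\<^sub>R (y - a))) has_derivative blinfun_apply (fx y t)) (at y within S)"
        by (simp add: fx[OF yt] linear_cmul[OF bounded_linear.linear[OF bl[OF seg[OF yt]]]] ac_simps)
    next
      fix y assume "y \<in> S"
      then show "(\<lambda>t. t ^ m * H (a + t *\<^sub>R (y - a))) integrable_on cbox 0 1"
        by (intro integrable_continuous continuous_intros
              continuous_on_compose2[OF smooth_on_continuous[OF Suc.prems]]) (use seg in auto)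
    qed
    then show ?thesis using at_within_open[OF x assms(1)] by simp
  qed
  show ?case
  proof (rule Ck_on_Suc_I[OF assms(1)])
    fix x assume x: "x \<in> S"
    show "((\<lambda>y. integral {0..1} (\<lambda>t. t ^ m * H (a + t *\<^sub>R (y - a)))) has_derivative
      blinfun_apply (integral (cbox 0 1) (fx x))) (at x)"
      using der[OF x] by simp
  next
    fix v
    show "Ck_on k S (\<lambda>x. blinfun_apply (integral (cbox 0 1) (fx x)) v)"
    proof (rule Ck_on_cong[OF assms(1) _ Suc.IH[OF smooth_on_frechet_derivative[OF Suc.prems], of "Suc m" v]])
      fix x assume x: "x \<in> S"
      have "continuous_on (cbox 0 1) (fx x)"
        using continuous_on_compose2[OF cont, of "cbox 0 1" "\<lambda>t. (x, t)"] x
        by (auto simp: continuous_on_Pair image_subset_iff)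
      then have "fx x integrable_on cbox 0 1" by (rule integrable_continuous)
      then have "blinfun_apply (integral (cbox 0 1) (fx x)) v = integral (cbox 0 1) (\<lambda>t. blinfun_apply (fx x t) v)"
        by (rule blinfun_apply_integral)
      also have "\<dots> = integral (cbox 0 1) (\<lambda>t. t ^ Suc m * ?H' (a + t *\<^sub>R (x - a)) v)"
        by (rule integral_cong) (simp add: fx x)
      finally show "integral {0..1} (\<lambda>t. t ^ Suc m * ?H' (a + t *\<^sub>R (x - a)) v) =
        blinfun_apply (integral (cbox 0 1) (fx x)) v" by simp
    qed
  qed
qed

text \<open>Integrate the derivative of F along the segment from a to y and expand y - a over
  \<open>Basis\<close>: \<open>G b\<close> is the mean of the b-th partial derivative over the
  segment.\<close>

lemma hadamard:
  fixes F :: "'a::euclidean_space \<Rightarrow> real"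
  assumes "open S" "convex S" "a \<in> S" "smooth_on S F"
  obtains G where "\<And>b. smooth_on S (G b)" "\<And>b. G b a = frechet_derivative F (at a) b"
    "\<And>y. y \<in> S \<Longrightarrow> F y = F a + (\<Sum>b\<in>Basis. ((y - a) \<bullet> b) * G b y)"
proof
  let ?F' = "\<lambda>z. frechet_derivative F (at z)"
  let ?G = "\<lambda>b y. integral {0..1} (\<lambda>t. ?F' (a + t *\<^sub>R (y - a)) b)"
  show "smooth_on S (?G b)" for b
    unfolding smooth_on_def
    using Ck_on_segment_integral[OF assms(1-3) smooth_on_frechet_derivative[OF assms(4)], of _ 0 b]
    by simp
  show "?G b a = ?F' a b" for b by simp
  fix y assume y: "y \<in> S"
  have seg: "a + t *\<^sub>R (y - a) \<in> S" if "t \<in> {0..1}" for t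
    using segment_mem[OF assms(2,3) y that] .
  have d: "(F has_derivative ?F' z) (at z)" if "z \<in> S" for z
    using smooth_on_has_derivative[OF assms(4) that] .
  have "((\<lambda>t. ?F' (a + t *\<^sub>R (y - a)) (y - a)) has_integral
      F (a + 1 *\<^sub>R (y - a)) - F (a + 0 *\<^sub>R (y - a))) {0..1}"
  proof (rule fundamental_theorem_of_calculus)
    fix t :: real assume t: "t \<in> {0..1}"
    have "((\<lambda>t. a + t *\<^sub>R (y - a)) has_derivative (\<lambda>s. s *\<^sub>R (y - a))) (at t within {0..1})"
      by (auto intro!: derivative_eq_intros)
    from has_derivative_compose[OF this d[OF seg[OF t]]]
    show "((\<lambda>t. F (a + t *\<^sub>R (y - a))) has_vector_derivative ?F' (a + t *\<^sub>R (y - a)) (y - a)) (at t within {0..1})"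
      by (simp add: has_vector_derivative_def linear_cmul[OF has_derivative_linear[OF d[OF seg[OF t]]]])
  qed simp
  then have "F y - F a = integral {0..1} (\<lambda>t. ?F' (a + t *\<^sub>R (y - a)) (y - a))"
    by (simp add: integral_unique)
  also have "\<dots> = integral {0..1} (\<lambda>t. \<Sum>b\<in>Basis. ((y - a) \<bullet> b) * ?F' (a + t *\<^sub>R (y - a)) b)"
    by (rule integral_cong)
       (subst linear_sum_Basis[OF has_derivative_linear[OF d[OF seg]]], auto)
  also have "\<dots> = (\<Sum>b\<in>Basis. integral {0..1} (\<lambda>t. ((y - a) \<bullet> b) * ?F' (a + t *\<^sub>R (y - a)) b))"
    by (rule integral_sum)
       (auto intro!: integrable_continuous_real continuous_intros seg
          continuous_on_compose2[OF smooth_on_continuous[OF smooth_on_frechet_derivative[OF assms(4)]]])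
  finally show "F y = F a + (\<Sum>b\<in>Basis. ((y - a) \<bullet> b) * ?G b y)" by simp
qed

text \<open>For j = 0 this is the classical flat function exp(-1/t). The extra powers of 1/t make
  the family closed, up to linear combinations, under differentiation.\<close>

definition flat_exp :: "nat \<Rightarrow> real \<Rightarrow> real" where
  "flat_exp j t = (if t > 0 then inverse t ^ j * exp (- inverse t) else 0)"

lemma flat_exp_tendsto_0: "(flat_exp j \<longlongrightarrow> 0) (at 0)"
proof -
  have "((\<lambda>t. inverse t ^ j / exp (inverse t)) \<longlongrightarrow> (0::real)) (at_right 0)"
    by (rule filterlim_compose[OF tendsto_power_div_exp_0 filterlim_inverse_at_top_right])
  then have r: "(flat_exp j \<longlongrightarrow> 0) (at_right 0)"
    by (rule Lim_transform_eventually)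
       (auto simp: flat_exp_def eventually_at_filter exp_minus divide_inverse)
  have l: "(flat_exp j \<longlongrightarrow> 0) (at_left 0)"
    by (rule Lim_transform_eventually[OF tendsto_const])
       (auto simp: flat_exp_def eventually_at_filter)
  show ?thesis using l r by (simp add: filterlim_split_at)
qed

lemma flat_exp_has_derivative:
  "(flat_exp j has_field_derivative flat_exp (j + 2) t - of_nat j * flat_exp (j + 1) t) (at t)"
proof (cases t "0::real" rule: linorder_cases)
  case less
  show ?thesis
    by (rule has_field_derivative_transform_within_open[of "\<lambda>_. 0" _ t "{..<0}"])
       (use less in \<open>auto simp: flat_exp_def\<close>)
next
  case equal
  \<comment> \<open>At 0 the difference quotient of \<open>flat_exp j\<close> is
    \<open>flat_exp (Suc j)\<close>.\<close>
  have "((\<lambda>h. (flat_exp j (0 + h) - flat_exp j 0) / h) \<longlongrightarrow> 0) (at 0)"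
    by (rule Lim_transform_eventually[OF flat_exp_tendsto_0[of "Suc j"]])
       (auto simp: flat_exp_def eventually_at_filter field_simps)
  then show ?thesis
    using equal by (simp add: DERIV_def flat_exp_def)
next
  case greater
  have "((\<lambda>t. inverse t ^ j * exp (- inverse t)) has_field_derivative
      flat_exp (j + 2) t - of_nat j * flat_exp (j + 1) t) (at t)"
    using greater
    by (cases j) (auto intro!: derivative_eq_intros simp: flat_exp_def field_simps power2_eq_square,
      subst (asm) power_eq_if, simp split: if_splits)
  then show ?thesis
    by (rule has_field_derivative_transform_within_open[of _ _ t "{0<..}"])
       (use greater in \<open>auto simp: flat_exp_def\<close>)
qed

lemma smooth_on_flat_exp: "smooth_on UNIV (flat_exp j)"
  unfolding smooth_on_def
proof
  fix k show "Ck_on k UNIV (flat_exp j)"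
  proof (induction k arbitrary: j)
    case 0
    show ?case
      by (auto intro!: continuous_at_imp_continuous_on DERIV_isCont[OF flat_exp_has_derivative])
  next
    case (Suc k)
    show ?case
    proof (rule Ck_on_Suc_I[OF open_UNIV])
      fix t
      show "(flat_exp j has_derivative
          (\<lambda>v. v *\<^sub>R (flat_exp (j + 2) t + (- of_nat j) *\<^sub>R flat_exp (j + 1) t))) (at t)"
        using flat_exp_has_derivative[of j t] by (simp add: has_field_derivative_def mult_commute_abs)
    next
      fix v :: real
      show "Ck_on k UNIV (\<lambda>t. v *\<^sub>R (flat_exp (j + 2) t + (- of_nat j) *\<^sub>R flat_exp (j + 1) t))"
        by (intro Ck_on_scaleR Ck_on_add Ck_on_const open_UNIV Suc)
    qed
  qed
qed

text \<open>With h = exp(-1/t) extended by 0, the quotient h(u) / (h(u) + h(v)) works for u = r^2 -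
  |x-a|^2 and v = |x-a|^2 - (r/2)^2: u is positive inside radius r, v outside radius r/2, so the
  denominator never vanishes. Squared distances keep u and v polynomial, hence smooth at a as
  well.\<close>

lemma smooth_bump_exists:
  fixes a :: "'a::euclidean_space"
  assumes "r > 0"
  obtains \<psi> :: "'a \<Rightarrow> real" where "smooth_on UNIV \<psi>" "\<And>x. \<psi> x \<ge> 0"
    "\<And>x. dist a x \<le> r / 2 \<Longrightarrow> \<psi> x = 1" "\<And>x. \<psi> x > 0 \<longleftrightarrow> dist a x < r"
proof
  let ?h = "flat_exp 0"
  let ?u = "\<lambda>x. r\<^sup>2 + - ((x + -a) \<bullet> (x + -a))"
  let ?v = "\<lambda>x. (x + -a) \<bullet> (x + -a) + - (r/2)\<^sup>2"
  let ?\<psi> = "\<lambda>x. ?h (?u x) * inverse (?h (?u x) + ?h (?v x))"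
  have h: "?h t \<ge> 0" "?h t > 0 \<longleftrightarrow> t > 0" for t by (auto simp: flat_exp_def)
  have sq: "(x + -a) \<bullet> (x + -a) = (dist a x)\<^sup>2" for x
    by (simp add: dist_norm power2_norm_eq_inner norm_minus_commute flip: power2_norm_eq_inner)
  have u: "?u x > 0 \<longleftrightarrow> dist a x < r" for x
    unfolding sq using assms power2_less_imp_less[of "dist a x" r] power_strict_mono[of "dist a x" r 2] by auto
  have v: "?v x > 0 \<longleftrightarrow> dist a x > r / 2" for x
    unfolding sq using assms power2_less_imp_less[of "r/2" "dist a x"] power_strict_mono[of "r/2" "dist a x" 2] by auto
  have pos: "?h (?u x) + ?h (?v x) > 0" for x
    using h[of "?u x"] h[of "?v x"] u[of x] v[of x] assms
    by (smt (verit) field_sum_of_halves)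
  have inner: "smooth_on UNIV (\<lambda>x. (x + -a) \<bullet> (x + -a))"
  proof (rule smooth_on_cong[OF open_UNIV])
    show "smooth_on UNIV (\<lambda>x. \<Sum>b\<in>Basis. ((x + -a) \<bullet> b) * ((x + -a) \<bullet> b))"
      by (intro smooth_on_sum smooth_on_mult smooth_on_linear[OF bounded_linear_inner_left]
            smooth_on_add smooth_on_ident smooth_on_const open_UNIV)
  qed (metis euclidean_inner)
  have hu: "smooth_on UNIV (\<lambda>x. ?h (?u x))"
    by (intro smooth_on_compose[OF _ open_UNIV _ smooth_on_flat_exp] smooth_on_add
          smooth_on_linear[OF bounded_linear_minus[OF bounded_linear_ident] _ inner]) auto
  have hv: "smooth_on UNIV (\<lambda>x. ?h (?v x))"
    by (intro smooth_on_compose[OF _ open_UNIV _ smooth_on_flat_exp] smooth_on_add inner) auto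
  show "smooth_on UNIV ?\<psi>"
    by (intro smooth_on_mult smooth_on_inverse smooth_on_add hu hv open_UNIV) (use pos in \<open>auto simp: less_le\<close>)
  show "?\<psi> x \<ge> 0" for x using h pos[of x] by (simp add: less_imp_le)
  show "?\<psi> x = 1" if "dist a x \<le> r / 2" for x
  proof -
    have "?h (?v x) = 0" using h[of "?v x"] v[of x] that by linarith
    then show ?thesis using pos[of x] by simp
  qed
  show "?\<psi> x > 0 \<longleftrightarrow> dist a x < r" for x
    using h(2)[of "?u x"] u[of x] pos[of x] h(1)[of "?u x"]
    by (simp add: zero_less_mult_iff)
qed

section \<open>Smooth functions and derivations on a manifold\<close>

locale atlas_manifold =
  fixes A :: "('m::{t2_space,second_countable_topology}, 'e::euclidean_space) chart set"
  assumes manifold: "smooth_manifold A"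
begin

lemma chart_facts:
  assumes "(U, \<phi>) \<in> A"
  shows "open U" "open (\<phi> ` U)" "inj_on \<phi> U" "homeomorphism U (\<phi> ` U) \<phi> (inv_into U \<phi>)"
    "continuous_on U \<phi>" "continuous_on (\<phi> ` U) (inv_into U \<phi>)"
    "\<And>q. q \<in> U \<Longrightarrow> inv_into U \<phi> (\<phi> q) = q"
proof -
  have "is_chart (U, \<phi>)" using assms manifold by (auto simp: smooth_manifold_def)
  then show "open U" "open (\<phi> ` U)" and h: "homeomorphism U (\<phi> ` U) \<phi> (inv_into U \<phi>)"
    by (auto simp: is_chart_def)
  show "inj_on \<phi> U"
    by (rule inj_on_inverseI[of _ "inv_into U \<phi>"]) (rule homeomorphism_apply1[OF h])
  show "continuous_on U \<phi>" "continuous_on (\<phi> ` U) (inv_into U \<phi>)"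
    using h by (auto simp: homeomorphism_def)
  show "inv_into U \<phi> (\<phi> q) = q" if "q \<in> U" for q
    using h that by (auto simp: homeomorphism_def)
qed

lemma chart_cover: obtains U \<phi> where "(U, \<phi>) \<in> A" "p \<in> U"
proof -
  have "p \<in> (\<Union>c\<in>A. fst c)" using manifold by (simp add: smooth_manifold_def)
  then show ?thesis using that by fastforce
qed

lemma open_chart_image:
  assumes "(U, \<phi>) \<in> A" "open V" "V \<subseteq> U"
  shows "open (\<phi> ` V)"
proof -
  have "openin (top_of_set U) V" using assms(2,3) by (rule open_subset[rotated])
  from homeomorphism_imp_open_map[OF chart_facts(4)[OF assms(1)] this]
  show ?thesis using chart_facts(2)[OF assms(1)] by (rule openin_open_trans)
qed

section \<open>Smooth functions on the manifold and their extension by zero\<close>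

lemma smooth_fun_chart:
  "smooth_fun A f \<Longrightarrow> (U, \<phi>) \<in> A \<Longrightarrow> smooth_on (\<phi> ` U) (\<lambda>y. f (inv_into U \<phi> y))"
  unfolding smooth_fun_def o_def by auto

lemma smooth_funI:
  "(\<And>U \<phi>. (U, \<phi>) \<in> A \<Longrightarrow> smooth_on (\<phi> ` U) (\<lambda>y. f (inv_into U \<phi> y))) \<Longrightarrow> smooth_fun A f"
  unfolding smooth_fun_def o_def by auto

lemma smooth_fun_const [simp]: "smooth_fun A (\<lambda>q. c)"
  by (rule smooth_funI, intro smooth_on_const, rule chart_facts(2))

lemma smooth_fun_add: "smooth_fun A f \<Longrightarrow> smooth_fun A g \<Longrightarrow> smooth_fun A (\<lambda>q. f q + g q)"
  by (rule smooth_funI, intro smooth_on_add chart_facts(2) smooth_fun_chart)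

lemma smooth_fun_mult: "smooth_fun A f \<Longrightarrow> smooth_fun A g \<Longrightarrow> smooth_fun A (\<lambda>q. f q * g q)"
  by (rule smooth_funI, intro smooth_on_mult chart_facts(2) smooth_fun_chart)

lemma smooth_fun_sum:
  "(\<And>i. i \<in> I \<Longrightarrow> smooth_fun A (f i)) \<Longrightarrow> smooth_fun A (\<lambda>q. \<Sum>i\<in>I. f i q)"
  by (rule smooth_funI, intro smooth_on_sum chart_facts(2) smooth_fun_chart)

lemma smooth_fun_diff:
  assumes "smooth_fun A f" "smooth_fun A g" shows "smooth_fun A (\<lambda>q. f q - g q)"
  using smooth_fun_add[OF assms(1) smooth_fun_mult[OF smooth_fun_const[of "-1"] assms(2)]] by simp

lemma smooth_fun_inverse:
  "smooth_fun A f \<Longrightarrow> (\<And>q. f q \<noteq> 0) \<Longrightarrow> smooth_fun A (\<lambda>q. inverse (f q))"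
  by (rule smooth_funI, intro smooth_on_inverse chart_facts(2) smooth_fun_chart)

lemma smooth_fun_continuous:
  assumes "smooth_fun A f" shows "continuous_on S f"
proof -
  have "isCont f p" for p
  proof -
    obtain U \<phi> where c: "(U, \<phi>) \<in> A" "p \<in> U" by (rule chart_cover)
    have "continuous_on U (\<lambda>q. f (inv_into U \<phi> (\<phi> q)))"
      by (rule continuous_on_compose2[OF smooth_on_continuous[OF smooth_fun_chart[OF assms c(1)]]
            chart_facts(5)[OF c(1)]]) simp
    then have "continuous_on U f"
      by (rule continuous_on_eq) (simp add: chart_facts(7)[OF c(1)])
    then show ?thesis using c chart_facts(1)[OF c(1)] by (simp add: continuous_on_eq_continuous_at)
  qed
  then show ?thesis by (simp add: continuous_at_imp_continuous_on)
qed

text \<open>Any other chart domain V is covered by the open sets V \<inter> W and V - K. On the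
  first, g is its representative in the given chart composed with a transition map; on the second, g
  is 0.\<close>

lemma smooth_fun_extend_by_0:
  assumes c: "(U, \<phi>) \<in> A" and W: "open W" "W \<subseteq> U" and K: "closed K" "K \<subseteq> W"
    and g: "smooth_on (\<phi> ` W) (\<lambda>y. g (inv_into U \<phi> y))" "\<And>q. q \<notin> K \<Longrightarrow> g q = 0"
  shows "smooth_fun A g"
proof (rule smooth_funI, rule smooth_on_local)
  fix V \<psi> y assume d: "(V, \<psi>) \<in> A" and "y \<in> \<psi> ` V"
  then obtain q where q: "q \<in> V" "y = \<psi> q" by auto
  show "\<exists>T. open T \<and> y \<in> T \<and> smooth_on T (\<lambda>y. g (inv_into V \<psi> y))"
  proof (cases "q \<in> W")
    case True
    let ?T = "\<psi> ` (V \<inter> W)"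
    have T: "open ?T"
      by (rule open_chart_image[OF d]) (use chart_facts(1)[OF d] W in auto)
    have tr: "smooth_on ?T (\<lambda>y. \<phi> (inv_into V \<psi> y))"
    proof -
      have "smooth_transition (V, \<psi>) (U, \<phi>)"
        using manifold c d by (auto simp: smooth_manifold_def)
      then have "smooth_on (\<psi> ` (V \<inter> U)) (\<lambda>y. \<phi> (inv_into V \<psi> y))"
        by (simp add: smooth_transition_def o_def)
      then show ?thesis by (rule smooth_on_subset) (use W in auto)
    qed
    have "smooth_on ?T (\<lambda>y. g (inv_into U \<phi> (\<phi> (inv_into V \<psi> y))))"
      by (rule smooth_on_compose[OF T _ _ g(1) tr])
         (use open_chart_image[OF c W] chart_facts(7)[OF d] in auto)
    then have "smooth_on ?T (\<lambda>y. g (inv_into V \<psi> y))"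
      by (rule smooth_on_cong[OF T, rotated])
         (use W chart_facts(7)[OF c] chart_facts(7)[OF d] in auto)
    then show ?thesis using T q True by blast
  next
    case False
    let ?T = "\<psi> ` (V - K)"
    have T: "open ?T"
      by (rule open_chart_image[OF d]) (use chart_facts(1)[OF d] K in auto)
    have "smooth_on ?T (\<lambda>y. g (inv_into V \<psi> y))"
      by (rule smooth_on_cong[OF T _ smooth_on_const[OF T, of 0]])
         (use chart_facts(7)[OF d] g(2) in auto)
    then show ?thesis using T q False K by blast
  qed
qed

text \<open>A compact set in the chart stays closed in the whole manifold because the manifold is
  Hausdorff; extension by zero relies on this.\<close>

lemma compact_chart_preimage:
  assumes "(U, \<phi>) \<in> A" "compact C" "C \<subseteq> \<phi> ` U"
  shows "compact (inv_into U \<phi> ` C)" "closed (inv_into U \<phi> ` C)" "inv_into U \<phi> ` C \<subseteq> U"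
proof -
  show "compact (inv_into U \<phi> ` C)"
    by (rule compact_continuous_image[OF continuous_on_subset[OF chart_facts(6)[OF assms(1)]]])
       (use assms in auto)
  then show "closed (inv_into U \<phi> ` C)" by (rule compact_imp_closed)
  show "inv_into U \<phi> ` C \<subseteq> U" using assms(3) by (auto intro!: inv_into_into)
qed

lemma smooth_fun_from_chart:
  assumes c: "(U, \<phi>) \<in> A" and S: "open S" "S \<subseteq> \<phi> ` U" "cball a r \<subseteq> S"
    and h: "smooth_on S h" "\<And>y. y \<in> S \<Longrightarrow> y \<notin> cball a r \<Longrightarrow> h y = 0"
  shows "smooth_fun A (\<lambda>q. if q \<in> U \<and> \<phi> q \<in> S then h (\<phi> q) else 0)"
proof -
  let ?i = "inv_into U \<phi>"
  let ?W = "{q \<in> U. \<phi> q \<in> S}"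
  have W: "open ?W"
    using continuous_open_preimage[OF chart_facts(5)[OF c] chart_facts(1)[OF c] S(1)]
    by (simp add: vimage_def Int_def)
  have im: "\<phi> ` ?W = S" using S(2) by auto
  have K: "closed (?i ` cball a r)"
    by (rule compact_chart_preimage[OF c]) (use S in auto)
  show ?thesis
  proof (rule smooth_fun_extend_by_0[OF c W _ K])
    show "?i ` cball a r \<subseteq> ?W"
      using S by (intro subsetI) (auto simp: f_inv_into_f inv_into_into subset_eq simp del: mem_cball)
    have "smooth_on S (\<lambda>y. if ?i y \<in> U \<and> \<phi> (?i y) \<in> S then h (\<phi> (?i y)) else 0)"
      by (rule smooth_on_cong[OF S(1) _ h(1)])
         (use S(2) in \<open>auto simp: f_inv_into_f inv_into_into subset_eq\<close>)
    then show "smooth_on (\<phi> ` ?W) (\<lambda>y. if ?i y \<in> U \<and> \<phi> (?i y) \<in> S then h (\<phi> (?i y)) else 0)"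
      by (simp add: im)
    fix q assume "q \<notin> ?i ` cball a r"
    then show "(if q \<in> U \<and> \<phi> q \<in> S then h (\<phi> q) else 0) = 0"
      using h(2)[of "\<phi> q"] chart_facts(7)[OF c, of q] image_eqI[of q ?i "\<phi> q" "cball a r"]
      by (cases "\<phi> q \<in> cball a r") auto
  qed auto
qed

lemma bump_fun_exists:
  assumes c: "(U, \<phi>) \<in> A" and r: "r > 0" "cball a r \<subseteq> \<phi> ` U"
  obtains \<beta> where "smooth_fun A \<beta>" "\<And>q. \<beta> q \<ge> 0"
    "\<And>q. q \<in> U \<Longrightarrow> dist a (\<phi> q) \<le> r / 2 \<Longrightarrow> \<beta> q = 1"
    "\<And>q. \<beta> q > 0 \<longleftrightarrow> q \<in> U \<and> dist a (\<phi> q) < r"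
proof -
  obtain \<psi> :: "'e \<Rightarrow> real" where \<psi>: "smooth_on UNIV \<psi>" "\<And>x. \<psi> x \<ge> 0"
    "\<And>x. dist a x \<le> r / 2 \<Longrightarrow> \<psi> x = 1" "\<And>x. \<psi> x > 0 \<longleftrightarrow> dist a x < r"
    using smooth_bump_exists[OF r(1), of a] by blast
  let ?\<beta> = "\<lambda>q. if q \<in> U \<and> \<phi> q \<in> \<phi> ` U then \<psi> (\<phi> q) else 0"
  have "smooth_fun A ?\<beta>"
    by (rule smooth_fun_from_chart[OF c chart_facts(2)[OF c] order_refl r(2)])
       (use smooth_on_subset[OF \<psi>(1)] \<psi>(2,4) in \<open>force simp: not_le less_le\<close>)+
  then show ?thesis
    by (rule that) (use \<psi> in auto)
qed

lemma bump_fun_nhd: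
  assumes "open N" "p \<in> N"
  obtains \<beta> where "smooth_fun A \<beta>" "\<beta> p = 1" "\<And>q. q \<notin> N \<Longrightarrow> \<beta> q = 0"
proof -
  obtain U \<phi> where c: "(U, \<phi>) \<in> A" "p \<in> U" by (rule chart_cover)
  have oV: "open (\<phi> ` (U \<inter> N))"
    by (rule open_chart_image[OF c(1)]) (use chart_facts(1)[OF c(1)] assms in auto)
  have "\<phi> p \<in> \<phi> ` (U \<inter> N)" using assms(2) c(2) by auto
  then obtain r where r: "r > 0" "cball (\<phi> p) r \<subseteq> \<phi> ` (U \<inter> N)"
    using open_contains_cball_eq[OF oV] by blast
  obtain \<beta> where \<beta>: "smooth_fun A \<beta>" "\<And>q. \<beta> q \<ge> 0"
    "\<And>q. q \<in> U \<Longrightarrow> dist (\<phi> p) (\<phi> q) \<le> r / 2 \<Longrightarrow> \<beta> q = 1"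
    "\<And>q. \<beta> q > 0 \<longleftrightarrow> q \<in> U \<and> dist (\<phi> p) (\<phi> q) < r"
    by (rule bump_fun_exists[OF c(1) r(1), of "\<phi> p"]) (use r in auto)
  show ?thesis
  proof (rule that[OF \<beta>(1)])
    show "\<beta> p = 1" using \<beta>(3)[OF c(2)] r(1) by simp
    fix q assume q: "q \<notin> N"
    have "\<not> (q \<in> U \<and> dist (\<phi> p) (\<phi> q) < r)"
    proof
      assume *: "q \<in> U \<and> dist (\<phi> p) (\<phi> q) < r"
      then obtain q' where "q' \<in> U \<inter> N" "\<phi> q = \<phi> q'" using r(2) by (force simp: subset_iff)
      then show False using inj_onD[OF chart_facts(3)[OF c(1)], of q q'] * q by auto
    qed
    then show "\<beta> q = 0" using \<beta>(2)[of q] \<beta>(4)[of q] by linarith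
  qed
qed

section \<open>Derivations at a point: algebra, locality, coordinates\<close>

lemma tangent_lin:
  "v \<in> tangent_space A p \<Longrightarrow> smooth_fun A f \<Longrightarrow> smooth_fun A g \<Longrightarrow>
    v (\<lambda>q. a * f q + b * g q) = a * v f + b * v g"
  by (auto simp: tangent_space_def)

lemma tangent_mult:
  "v \<in> tangent_space A p \<Longrightarrow> smooth_fun A f \<Longrightarrow> smooth_fun A g \<Longrightarrow>
    v (\<lambda>q. f q * g q) = f p * v g + g p * v f"
  by (auto simp: tangent_space_def)

lemma tangent_non_smooth: "v \<in> tangent_space A p \<Longrightarrow> \<not> smooth_fun A f \<Longrightarrow> v f = 0"
  by (auto simp: tangent_space_def)

text \<open>The product rule for 1 * 1 gives v(1) = 2 v(1); linearity does the rest.\<close>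

lemma tangent_const: "v \<in> tangent_space A p \<Longrightarrow> v (\<lambda>q. c) = 0"
  using tangent_mult[of v p "\<lambda>q. 1" "\<lambda>q. 1"] tangent_lin[of v p "\<lambda>q. 1" "\<lambda>q. 1" c 0] by simp

lemma tangent_add:
  "v \<in> tangent_space A p \<Longrightarrow> smooth_fun A f \<Longrightarrow> smooth_fun A g \<Longrightarrow> v (\<lambda>q. f q + g q) = v f + v g"
  using tangent_lin[of v p f g 1 1] by simp

lemma tangent_diff:
  "v \<in> tangent_space A p \<Longrightarrow> smooth_fun A f \<Longrightarrow> smooth_fun A g \<Longrightarrow> v (\<lambda>q. f q - g q) = v f - v g"
  using tangent_lin[of v p f g 1 "-1"] by simp

lemma tangent_sum:
  assumes "v \<in> tangent_space A p"
  shows "(\<And>i. i \<in> I \<Longrightarrow> smooth_fun A (f i)) \<Longrightarrow> v (\<lambda>q. \<Sum>i\<in>I. f i q) = (\<Sum>i\<in>I. v (f i))"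
  by (induction I rule: infinite_finite_induct)
     (simp_all add: tangent_const[OF assms] tangent_add[OF assms] smooth_fun_sum)

text \<open>For a bump function \<beta> with \<beta>(p) = 1 and zero outside N, the product \<beta>
  (f - g) is identically 0, and the product rule at p leaves only v(f - g).\<close>

lemma tangent_local:
  assumes v: "v \<in> tangent_space A p" and f: "smooth_fun A f" "smooth_fun A g"
    and N: "open N" "p \<in> N" "\<And>q. q \<in> N \<Longrightarrow> f q = g q"
  shows "v f = v g"
proof -
  obtain \<beta> where \<beta>: "smooth_fun A \<beta>" "\<beta> p = 1" "\<And>q. q \<notin> N \<Longrightarrow> \<beta> q = 0"
    using bump_fun_nhd[OF N(1,2)] by blast
  have "(\<lambda>q. \<beta> q * (f q - g q)) = (\<lambda>q. 0)" using \<beta>(3) N(3) by fastforce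
  then have "0 = v (\<lambda>q. \<beta> q * (f q - g q))" using tangent_const[OF v] by simp
  also have "\<dots> = v f - v g"
    using tangent_mult[OF v \<beta>(1) smooth_fun_diff[OF f]] \<beta>(2) N tangent_diff[OF v f] by simp
  finally show ?thesis by simp
qed

lemma vector_field_tangent: "X \<in> vector_fields A \<Longrightarrow> X p \<in> tangent_space A p"
  by (auto simp: vector_fields_def)

lemma vector_field_smooth: "X \<in> vector_fields A \<Longrightarrow> smooth_fun A f \<Longrightarrow> smooth_fun A (\<lambda>p. X p f)"
  by (auto simp: vector_fields_def)

text \<open>Derivations at \<open>p\<close> are determined by their values on coordinate functions: subtract the
  value at \<open>p\<close> and write the remainder by Hadamard's lemma as a sum of products of functions,
  the first factor of each vanishing at \<open>p\<close>.\<close>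

lemma tangent_coordinates:
  assumes c: "(U, \<phi>) \<in> A" and W: "open W" "W \<subseteq> U" "p \<in> W"
    and x: "\<And>b. b \<in> Basis \<Longrightarrow> smooth_fun A (x b)" "\<And>b q. b \<in> Basis \<Longrightarrow> q \<in> W \<Longrightarrow> x b q = \<phi> q \<bullet> b"
    and v: "v \<in> tangent_space A p" and f: "smooth_fun A f"
  shows "v f = (\<Sum>b\<in>Basis. v (x b) * frechet_derivative (\<lambda>y. f (inv_into U \<phi> y)) (at (\<phi> p)) b)"
proof -
  let ?F = "\<lambda>y. f (inv_into U \<phi> y)"
  let ?a = "\<phi> p"
  note oW = open_chart_image[OF c W(1,2)]
  have "?a \<in> \<phi> ` W" using W(3) by auto
  then obtain r where r: "r > 0" "ball ?a r \<subseteq> \<phi> ` W"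
    using open_contains_ball_eq[OF oW] by blast
  have rU: "ball ?a r \<subseteq> \<phi> ` U" using r W by blast
  have smF: "smooth_on (ball ?a r) ?F"
    using smooth_on_subset[OF smooth_fun_chart[OF f c] rU] .
  obtain G where G: "\<And>b. smooth_on (ball ?a r) (G b)" "\<And>b. G b ?a = frechet_derivative ?F (at ?a) b"
    "\<And>y. y \<in> ball ?a r \<Longrightarrow> ?F y = ?F ?a + (\<Sum>b\<in>Basis. ((y - ?a) \<bullet> b) * G b y)"
    by (rule hadamard[OF open_ball convex_ball _ smF]) (use r in auto)
  obtain \<psi> :: "'e \<Rightarrow> real" where \<psi>: "smooth_on UNIV \<psi>" "\<And>y. \<psi> y \<ge> 0"
    "\<And>y. dist ?a y \<le> (r/2) / 2 \<Longrightarrow> \<psi> y = 1" "\<And>y. \<psi> y > 0 \<longleftrightarrow> dist ?a y < r/2"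
    using smooth_bump_exists[OF half_gt_zero[OF r(1)], of ?a] by blast
  \<comment> \<open>The Hadamard factors \<open>G b\<close> exist only near p and in coordinates. As
    \<open>\<psi>\<close> vanishes off radius r/2, the product is a global smooth function; as
    \<open>\<psi>\<close> is 1 up to radius r/4, it agrees with \<open>G b\<close> on the set
    \<open>N\<close> below.\<close>
  define g where "g b q = (if q \<in> U \<and> \<phi> q \<in> ball ?a r then \<psi> (\<phi> q) * G b (\<phi> q) else 0)" for b q
  have g: "smooth_fun A (g b)" for b
    unfolding g_def
  proof (rule smooth_fun_from_chart[OF c open_ball rU])
    show "cball ?a (r/2) \<subseteq> ball ?a r" using r by auto
    show "smooth_on (ball ?a r) (\<lambda>y. \<psi> y * G b y)"
      by (intro smooth_on_mult G open_ball smooth_on_subset[OF \<psi>(1)]) auto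
    fix y assume "y \<notin> cball ?a (r/2)"
    then have "\<psi> y = 0" using \<psi>(2)[of y] \<psi>(4)[of y] by auto
    then show "\<psi> y * G b y = 0" by simp
  qed
  define N where "N = {q \<in> W. \<phi> q \<in> ball ?a (r/4)}"
  have N: "open N"
    using continuous_open_preimage[OF continuous_on_subset[OF chart_facts(5)[OF c] W(2)] W(1)
        open_ball, of ?a "r/4"]
    by (simp add: vimage_def Int_def N_def)
  have pU: "p \<in> U" using W by auto
  have gp: "g b p = frechet_derivative ?F (at ?a) b" for b
    using pU r \<psi>(3)[of ?a] G(2) by (simp add: g_def)
  have "v f = v (\<lambda>q. f p + (\<Sum>b\<in>Basis. (x b q - ?a \<bullet> b) * g b q))"
  proof (rule tangent_local[OF v f _ N])
    show "smooth_fun A (\<lambda>q. f p + (\<Sum>b\<in>Basis. (x b q - ?a \<bullet> b) * g b q))"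
      by (intro smooth_fun_add smooth_fun_sum smooth_fun_mult smooth_fun_diff smooth_fun_const x g)
    show "p \<in> N" using W r by (simp add: N_def)
    fix q assume q: "q \<in> N"
    then have q': "q \<in> W" "q \<in> U" "dist ?a (\<phi> q) < r / 4" using W by (auto simp: N_def)
    then have b: "\<phi> q \<in> ball ?a r" "g b q = G b (\<phi> q)" for b
      using r \<psi>(3)[of "\<phi> q"] by (auto simp: g_def)
    show "f q = f p + (\<Sum>b\<in>Basis. (x b q - ?a \<bullet> b) * g b q)"
      using G(3)[OF b(1)] pU q' by (simp add: b(2) chart_facts(7)[OF c] x inner_diff_left)
  qed
  also have "\<dots> = (\<Sum>b\<in>Basis. v (\<lambda>q. (x b q - ?a \<bullet> b) * g b q))"
    using x g by (simp add: tangent_add[OF v] tangent_const[OF v] tangent_sum[OF v]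
        smooth_fun_sum smooth_fun_mult smooth_fun_diff)
  also have "\<dots> = (\<Sum>b\<in>Basis. v (x b) * frechet_derivative ?F (at ?a) b)"
    by (rule sum.cong)
       (use x g W gp in \<open>simp_all add: tangent_mult[OF v] smooth_fun_diff tangent_diff[OF v] tangent_const[OF v]\<close>)
  finally show ?thesis .
qed

text \<open>A coordinate derivative multiplied by a cut-off \<open>\<beta>\<close> becomes a global
  field. The test for \<open>smooth_fun A f\<close> implements the convention that tangent vectors
  are 0 on non-smooth functions.\<close>

lemma chart_field:
  assumes c: "(U, \<phi>) \<in> A" and r: "cball a r \<subseteq> \<phi> ` U"
    and \<beta>: "smooth_fun A \<beta>" "\<And>q. \<beta> q \<noteq> 0 \<Longrightarrow> q \<in> U \<and> \<phi> q \<in> cball a r"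
  shows "(\<lambda>q f. if q \<in> U \<and> smooth_fun A f
      then \<beta> q * frechet_derivative (\<lambda>y. f (inv_into U \<phi> y)) (at (\<phi> q)) b else 0) \<in> vector_fields A"
    (is "?X \<in> _")
proof -
  let ?i = "inv_into U \<phi>"
  let ?D = "\<lambda>f q. frechet_derivative (\<lambda>y. f (?i y)) (at (\<phi> q)) b"
  have der: "((\<lambda>y. f (?i y)) has_derivative frechet_derivative (\<lambda>y. f (?i y)) (at (\<phi> q))) (at (\<phi> q))"
    if "smooth_fun A f" "q \<in> U" for f q
    by (rule smooth_on_has_derivative[OF smooth_fun_chart[OF that(1) c]]) (use that in auto)
  have lin: "?D (\<lambda>q. s * f q + t * g q) q = s * ?D f q + t * ?D g q"
    if "smooth_fun A f" "smooth_fun A g" "q \<in> U" for f g s t q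
    by (subst frechet_derivative_eq[OF has_derivative_add[OF has_derivative_mult_right[OF
            der[OF that(1,3)], of s] has_derivative_mult_right[OF der[OF that(2,3)], of t]]]) simp
  have mult: "?D (\<lambda>q. f q * g q) q = f q * ?D g q + g q * ?D f q"
    if "smooth_fun A f" "smooth_fun A g" "q \<in> U" for f g q
    by (subst frechet_derivative_eq[OF has_derivative_mult[OF der[OF that(1,3)] der[OF that(2,3)]]])
       (simp add: chart_facts(7)[OF c that(3)])
  have "?X q \<in> tangent_space A q" for q
    unfolding tangent_space_def mem_Collect_eq
    using lin mult
    by (auto simp: smooth_fun_add smooth_fun_mult algebra_simps)
  moreover have "smooth_fun A (\<lambda>q. ?X q f)" if f: "smooth_fun A f" for f
  proof (rule smooth_fun_extend_by_0[OF c chart_facts(1)[OF c] order_refl])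
    show "closed (?i ` cball a r)" "?i ` cball a r \<subseteq> U"
      using compact_chart_preimage[OF c _ r] by auto
    show "smooth_on (\<phi> ` U) (\<lambda>y. ?X (?i y) f)"
    proof (rule smooth_on_cong[OF chart_facts(2)[OF c]])
      show "smooth_on (\<phi> ` U) (\<lambda>y. \<beta> (?i y) * frechet_derivative (\<lambda>y. f (?i y)) (at y) b)"
        by (intro smooth_on_mult smooth_fun_chart \<beta> c chart_facts(2) smooth_on_frechet_derivative f)
    qed (use f in \<open>auto simp: chart_facts(7)[OF c]\<close>)
    fix q assume "q \<notin> ?i ` cball a r"
    then have "\<beta> q = 0" using \<beta>(2)[of q] chart_facts(7)[OF c, of q]
        image_eqI[of q ?i "\<phi> q" "cball a r"]
      by (cases "\<phi> q \<in> cball a r") auto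
    then show "?X q f = 0" by simp
  qed
  ultimately show ?thesis by (auto simp: vector_fields_def)
qed

end

section \<open>Alternating forms and determinants\<close>

definition apply_matrix :: "real^'n::finite^'n \<Rightarrow> ('n \<Rightarrow> 'f \<Rightarrow> real) \<Rightarrow> 'n \<Rightarrow> 'f \<Rightarrow> real" where
  "apply_matrix M V = (\<lambda>i f. \<Sum>j\<in>UNIV. M $ i $ j * V j f)"

lemma apply_matrix_mult: "apply_matrix (M ** N) V = apply_matrix M (apply_matrix N V)"
  unfolding apply_matrix_def matrix_matrix_mult_def
  by (intro ext) (simp add: sum_distrib_left sum_distrib_right mult.assoc, rule sum.swap)

text \<open>The arguments are indexed by a finite type instead of listed, so that square matrices
  over that type act on them and \<open>det\<close> applies. \<open>T\<close> is a set of
  functionals closed under linear combinations, since tangent spaces are sets and not types.\<close>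

locale alternating_family =
  fixes T :: "('f \<Rightarrow> real) set" and F :: "('n::finite \<Rightarrow> 'f \<Rightarrow> real) \<Rightarrow> real"
  assumes combination: "\<And>u w a b. u \<in> T \<Longrightarrow> w \<in> T \<Longrightarrow> (\<lambda>f. a * u f + b * w f) \<in> T"
    and nonempty: "T \<noteq> {}"
    and lin: "\<And>V i u w a b. range V \<subseteq> T \<Longrightarrow> u \<in> T \<Longrightarrow> w \<in> T \<Longrightarrow>
      F (V(i := (\<lambda>f. a * u f + b * w f))) = a * F (V(i := u)) + b * F (V(i := w))"
    and alt: "\<And>V i j. range V \<subseteq> T \<Longrightarrow> i \<noteq> j \<Longrightarrow> V i = V j \<Longrightarrow> F V = 0"
begin

lemma zero_mem: "(\<lambda>f. 0) \<in> T"
  using nonempty combination[of _ _ 0 0] by auto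

lemma scale_mem: "u \<in> T \<Longrightarrow> (\<lambda>f. c * u f) \<in> T"
  using combination[of u u c 0] by simp

lemma sum_mem: "(\<And>j. j \<in> J \<Longrightarrow> u j \<in> T) \<Longrightarrow> (\<lambda>f. \<Sum>j\<in>J. c j * u j f) \<in> T"
proof (induction J rule: infinite_finite_induct)
  case (insert x J)
  then show ?case using combination[of "u x" "\<lambda>f. \<Sum>j\<in>J. c j * u j f" "c x" 1] by simp
qed (simp_all add: zero_mem)

lemma update_scale:
  "range V \<subseteq> T \<Longrightarrow> u \<in> T \<Longrightarrow> F (V(i := (\<lambda>f. c * u f))) = c * F (V(i := u))"
  using lin[of V u u i c 0] by simp

lemma update_sum:
  assumes "range V \<subseteq> T"
  shows "(\<And>j. j \<in> J \<Longrightarrow> u j \<in> T) \<Longrightarrow>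
    F (V(i := (\<lambda>f. \<Sum>j\<in>J. c j * u j f))) = (\<Sum>j\<in>J. c j * F (V(i := u j)))"
proof (induction J rule: infinite_finite_induct)
  case (insert x J)
  then show ?case
    using lin[OF assms, of "u x" "\<lambda>f. \<Sum>j\<in>J. c j * u j f" i "c x" 1] sum_mem[of J u c]
    by (simp del: fun_upd_apply)
qed (use update_scale[OF assms zero_mem, of i 0] in simp_all)

text \<open>Only the k-th summand survives: every other one has \<open>V j\<close> both in slot j
  and in slot k. This is what extracts diagonal components, hence a trace, from a covariant
  derivative.\<close>

lemma update_combination:
  assumes "range V \<subseteq> T"
  shows "F (V(k := (\<lambda>f. \<Sum>j\<in>UNIV. c j * V j f))) = c k * F V"
proof -
  have "F (V(k := (\<lambda>f. \<Sum>j\<in>UNIV. c j * V j f))) = (\<Sum>j\<in>UNIV. c j * F (V(k := V j)))"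
    by (rule update_sum[OF assms]) (use assms in auto)
  also have "\<dots> = (\<Sum>j\<in>UNIV. if j = k then c k * F V else 0)"
    by (rule sum.cong) (use assms in \<open>auto intro!: alt[of _ k]\<close>)
  finally show ?thesis by simp
qed

text \<open>Polarization: expand F with V i + V j placed in both slots, where it vanishes.\<close>

lemma swap:
  assumes V: "range V \<subseteq> T" and ij: "i \<noteq> j"
  shows "F (V \<circ> Transposition.transpose i j) = - F V"
proof -
  have m: "V k \<in> T" for k using V by auto
  define G where "G u w = F (V(i := u, j := w))" for u w
  have l1: "G (\<lambda>f. 1 * u f + 1 * u' f) w = 1 * G u w + 1 * G u' w" if "u \<in> T" "u' \<in> T" "w \<in> T" for u u' w
    using lin[of "V(j := w)" u u' i 1 1] that V ij by (auto simp: G_def fun_upd_twist)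
  have l2: "G w (\<lambda>f. 1 * u f + 1 * u' f) = 1 * G w u + 1 * G w u'" if "u \<in> T" "u' \<in> T" "w \<in> T" for u u' w
    unfolding G_def by (rule lin) (use that V in auto)
  have z: "G u u = 0" if "u \<in> T" for u
    unfolding G_def by (rule alt[of _ i j]) (use that V ij in auto)
  let ?s = "\<lambda>f. 1 * V i f + 1 * V j f"
  have s: "?s \<in> T" by (rule combination[OF m m])
  have "0 = G ?s ?s" using z[OF s] by simp
  also have "\<dots> = G (V i) (V j) + G (V j) (V i)"
    by (simp only: l1[OF m m s] l2[OF m m m] z[OF m]) simp
  finally have "G (V j) (V i) = - G (V i) (V j)" by simp
  moreover have "V \<circ> Transposition.transpose i j = V(i := V j, j := V i)"
    using ij by (auto simp: fun_eq_iff Transposition.transpose_def)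
  ultimately show ?thesis by (simp add: G_def)
qed

lemma apply_matrix_mem: "range V \<subseteq> T \<Longrightarrow> range (apply_matrix M V) \<subseteq> T"
  unfolding apply_matrix_def by (auto intro!: sum_mem)

lemma scale_all:
  assumes "range V \<subseteq> T"
  shows "F (\<lambda>i. if i \<in> S then (\<lambda>f. c i * V i f) else V i) = (\<Prod>i\<in>S. c i) * F V"
proof -
  have "finite S" by simp
  then show ?thesis
  proof induction
    case (insert k S)
    let ?W = "\<lambda>i. if i \<in> S then (\<lambda>f. c i * V i f) else V i"
    have W: "range ?W \<subseteq> T" using assms by (auto intro!: scale_mem)
    have "(\<lambda>i. if i \<in> insert k S then (\<lambda>f. c i * V i f) else V i) = ?W(k := (\<lambda>f. c k * V k f))"
      by auto
    moreover have "?W(k := V k) = ?W" using insert.hyps by auto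
    moreover have "F (?W(k := (\<lambda>f. c k * V k f))) = c k * F (?W(k := V k))"
      by (rule update_scale[OF W]) (use assms in auto)
    ultimately show ?case using insert by simp
  qed simp
qed

text \<open>Both sides are multiplicative in M, so elementary matrices suffice. V stays arbitrary in
  the induction because the right factor of a product replaces V by \<open>apply_matrix N V\<close>.
  Absolute values are enough for densities and spare the sign of a transposition.\<close>

lemma abs_apply_matrix:
  "range V \<subseteq> T \<Longrightarrow> \<bar>F (apply_matrix M V)\<bar> = \<bar>det M\<bar> * \<bar>F V\<bar>"
proof (induction M arbitrary: V rule: induct_matrix_elementary[case_names mult zero_row diagonal swap1 idplus])
  case (mult M N)
  then show ?case
    by (simp add: apply_matrix_mult apply_matrix_mem det_mul abs_mult)
next
  case (zero_row M i)
  let ?W = "apply_matrix M V"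
  have "?W = ?W(i := (\<lambda>f. 0 * ?W i f))"
    using zero_row(1) by (auto simp: apply_matrix_def row_def vec_eq_iff fun_eq_iff)
  moreover have "F (?W(i := (\<lambda>f. 0 * ?W i f))) = 0 * F (?W(i := ?W i))"
    by (rule update_scale) (use apply_matrix_mem[OF zero_row(2), of M] in auto)
  ultimately have "F ?W = 0" by simp
  then show ?case using det_zero_row(1)[OF zero_row(1)] by simp
next
  case (diagonal M)
  have "apply_matrix M V = (\<lambda>i. if i \<in> UNIV then (\<lambda>f. M $ i $ i * V i f) else V i)"
  proof (intro ext)
    fix i f
    have "(\<Sum>j\<in>UNIV. M $ i $ j * V j f) = (\<Sum>j\<in>UNIV. if j = i then M $ i $ i * V i f else 0)"
      by (rule sum.cong) (use diagonal(1) in auto)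
    then show "apply_matrix M V i f = (if i \<in> UNIV then (\<lambda>f. M $ i $ i * V i f) else V i) f"
      by (simp add: apply_matrix_def)
  qed
  then show ?case
    using scale_all[OF diagonal(2), of UNIV "\<lambda>i. M $ i $ i"] det_diagonal[of M] diagonal(1)
    by (simp add: abs_mult)
next
  case (swap1 m n)
  let ?\<tau> = "Transposition.transpose m n"
  let ?M = "(\<chi> i j. mat 1 $ i $ ?\<tau> j) :: real^'n^'n"
  have "apply_matrix ?M V = V \<circ> ?\<tau>"
  proof (intro ext)
    fix i f
    have "(\<Sum>j\<in>UNIV. ?M $ i $ j * V j f) = (\<Sum>j\<in>UNIV. if j = ?\<tau> i then V j f else 0)"
      by (rule sum.cong) (auto simp: mat_def)
    then show "apply_matrix ?M V i f = (V \<circ> ?\<tau>) i f" by (simp add: apply_matrix_def)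
  qed
  moreover have "\<bar>det ?M\<bar> = 1"
    using det_permute_columns[of ?\<tau> "mat 1 :: real^'n^'n"] swap1(1)
    by (simp add: permutes_swap_id sign_swap_id)
  ultimately show ?case using swap[OF swap1(2,1)] by (simp add: o_def)
next
  case (idplus m n c)
  let ?M = "(\<chi> i j. if i = m \<and> j = n then c else of_bool (i = j)) :: real^'n^'n"
  have m: "V k \<in> T" for k using idplus by auto
  have eq: "apply_matrix ?M V = V(m := (\<lambda>f. 1 * V m f + c * V n f))"
  proof (intro ext)
    fix i f
    have "(\<Sum>j\<in>UNIV. ?M $ i $ j * V j f) =
      (\<Sum>j\<in>UNIV. (if j = i then V j f else 0) + (if j = n then (if i = m then c * V j f else 0) else 0))"
      by (rule sum.cong) (use idplus(1) in auto)
    then show "apply_matrix ?M V i f = (V(m := (\<lambda>f. 1 * V m f + c * V n f))) i f"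
      by (simp add: apply_matrix_def sum.distrib)
  qed
  have "F (V(m := V n)) = 0"
    by (rule alt[of _ m n]) (use m idplus(1) in auto)
  then have "F (apply_matrix ?M V) = F V"
    unfolding eq using lin[OF idplus(2) m m, of m 1 m c n] by simp
  moreover have "det ?M = 1"
  proof -
    have "?M = (\<chi> i. if i = m then row m (mat 1) + c *s row n (mat 1) else row i (mat 1))"
      using idplus(1) by (auto simp: vec_eq_iff row_def mat_def)
    then show ?thesis using det_row_operation[OF idplus(1), of "mat 1" c] by simp
  qed
  ultimately show ?case by simp
qed

end

section \<open>Coordinate balls with global frames\<close>

lemma sum_Basis_axis:
  fixes f :: "real^'n::finite \<Rightarrow> real"
  shows "(\<Sum>b\<in>Basis. f b) = (\<Sum>i\<in>UNIV. f (axis i 1))"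
proof -
  have B: "(Basis :: (real^'n) set) = (\<lambda>i. axis i 1) ` UNIV" by (auto simp: Basis_vec_def)
  show ?thesis
    unfolding B by (subst sum.reindex) (auto simp: inj_on_def axis_eq_axis)
qed

text \<open>A chart onto a Euclidean ball together with global objects: on W the fields
  \<open>X i\<close> are the coordinate fields and the functions \<open>x i\<close> the coordinates,
  and nothing is said about them elsewhere. Being global, they may be fed to a connection, a form or
  a tangent vector.\<close>

locale coordinate_ball = atlas_manifold A
  for A :: "('m::{t2_space,second_countable_topology}, real^'n::finite) chart set" +
  fixes W :: "'m set" and \<xi> :: "'m \<Rightarrow> real^'n" and \<eta> :: "real^'n \<Rightarrow> 'm"
    and a :: "real^'n" and s :: real and X :: "'n \<Rightarrow> 'm vfield" and x :: "'n \<Rightarrow> 'm \<Rightarrow> real"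
  assumes s_pos: "s > 0" and open_W: "open W" and homeo: "homeomorphism W (ball a s) \<xi> \<eta>"
    and smooth_rep: "\<And>f. smooth_fun A f \<Longrightarrow> smooth_on (ball a s) (\<lambda>y. f (\<eta> y))"
    and x_smooth: "\<And>i. smooth_fun A (x i)" and x_eq: "\<And>i q. q \<in> W \<Longrightarrow> x i q = \<xi> q $ i"
    and X_field: "\<And>i. X i \<in> vector_fields A"
    and X_eq: "\<And>i q f. q \<in> W \<Longrightarrow> smooth_fun A f \<Longrightarrow>
      X i q f = frechet_derivative (\<lambda>y. f (\<eta> y)) (at (\<xi> q)) (axis i 1)"
    and tangent_expansion: "\<And>q v f. q \<in> W \<Longrightarrow> v \<in> tangent_space A q \<Longrightarrow> smooth_fun A f \<Longrightarrow>
      v f = (\<Sum>i\<in>UNIV. v (x i) * X i q f)"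

text \<open>The function \<beta> supplies the raw material for a partition of unity: it is supported
  in the ball of half the radius, whose closure is compact inside W.\<close>

lemma coordinate_ball_exists:
  fixes A :: "('m::{t2_space,second_countable_topology}, real^'n::finite) chart set"
  assumes "smooth_manifold A"
  obtains W \<xi> \<eta> a s X x \<beta> where "coordinate_ball A W \<xi> \<eta> a s X x" "smooth_fun A \<beta>"
    "\<And>q. \<beta> q \<ge> 0" "\<beta> p > 0" "\<And>q. \<beta> q \<noteq> 0 \<Longrightarrow> q \<in> \<eta> ` cball a (s / 2)"
proof -
  interpret atlas_manifold A by unfold_locales (rule assms)
  obtain U \<phi> where c: "(U, \<phi>) \<in> A" "p \<in> U" by (rule chart_cover)
  let ?i = "inv_into U \<phi>"
  define a where "a = \<phi> p"
  have "a \<in> \<phi> ` U" using c by (auto simp: a_def)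
  then obtain r where r: "r > 0" "cball a r \<subseteq> \<phi> ` U"
    using open_contains_cball_eq[OF chart_facts(2)[OF c(1)]] by blast
  \<comment> \<open>The cut-offs \<open>\<gamma>\<close> for the fields and \<open>\<psi>\<close>
    for the coordinates have radius r and equal 1 up to radius r/2, hence on all of W.\<close>
  define s where "s = r / 2"
  have s: "s > 0" using r by (simp add: s_def)
  define W where "W = {q \<in> U. dist a (\<phi> q) < s}"
  have W: "open W" "W \<subseteq> U" "p \<in> W"
    using continuous_open_preimage[OF chart_facts(5,1)[OF c(1)] open_ball, of a s] c(2) s
    by (auto simp: vimage_def Int_def W_def a_def)
  have im: "\<phi> ` W = ball a s"
  proof
    show "ball a s \<subseteq> \<phi> ` W"
    proof
      fix y assume y: "y \<in> ball a s"
      then have "y \<in> \<phi> ` U" using r by (auto simp: s_def subset_iff)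
      then show "y \<in> \<phi> ` W" using y by (auto simp: W_def)
    qed
  qed (auto simp: W_def)
  obtain \<gamma> where \<gamma>: "smooth_fun A \<gamma>" "\<And>q. \<gamma> q \<ge> 0"
    "\<And>q. q \<in> U \<Longrightarrow> dist a (\<phi> q) \<le> r / 2 \<Longrightarrow> \<gamma> q = 1"
    "\<And>q. \<gamma> q > 0 \<longleftrightarrow> q \<in> U \<and> dist a (\<phi> q) < r"
    using bump_fun_exists[OF c(1) r] by blast
  obtain \<psi> :: "real^'n \<Rightarrow> real" where \<psi>: "smooth_on UNIV \<psi>" "\<And>y. \<psi> y \<ge> 0"
    "\<And>y. dist a y \<le> r / 2 \<Longrightarrow> \<psi> y = 1" "\<And>y. \<psi> y > 0 \<longleftrightarrow> dist a y < r"
    using smooth_bump_exists[OF r(1), of a] by blast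
  have "s/2 > 0" "cball a (s/2) \<subseteq> \<phi> ` U" using s r by (auto simp: s_def subset_iff)
  then obtain \<beta> where \<beta>: "smooth_fun A \<beta>" "\<And>q. \<beta> q \<ge> 0"
    "\<And>q. q \<in> U \<Longrightarrow> dist a (\<phi> q) \<le> s / 2 / 2 \<Longrightarrow> \<beta> q = 1"
    "\<And>q. \<beta> q > 0 \<longleftrightarrow> q \<in> U \<and> dist a (\<phi> q) < s / 2"
    using bump_fun_exists[OF c(1)] by blast
  define x where "x i q = (if q \<in> U \<and> \<phi> q \<in> \<phi> ` U then \<psi> (\<phi> q) * (\<phi> q $ i) else 0)" for i q
  have x: "smooth_fun A (x i)" for i
    unfolding x_def
  proof (rule smooth_fun_from_chart[OF c(1) chart_facts(2)[OF c(1)] order_refl r(2)])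
    show "smooth_on (\<phi> ` U) (\<lambda>y. \<psi> y * (y $ i))"
      by (intro smooth_on_mult smooth_on_linear[OF bounded_linear_vec_nth] smooth_on_ident
            chart_facts(2) c(1) smooth_on_subset[OF \<psi>(1)]) auto
    fix y assume "y \<notin> cball a r"
    then have "\<psi> y = 0" using \<psi>(2)[of y] \<psi>(4)[of y] by auto
    then show "\<psi> y * (y $ i) = 0" by simp
  qed
  have xW: "x i q = \<phi> q $ i" if "q \<in> W" for i q
    using that \<psi>(3)[of "\<phi> q"] by (auto simp: x_def W_def s_def)
  define X :: "'n \<Rightarrow> 'm vfield" where
    "X i = (\<lambda>q f. if q \<in> U \<and> smooth_fun A f
      then \<gamma> q * frechet_derivative (\<lambda>y. f (?i y)) (at (\<phi> q)) (axis i 1) else 0)" for i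
  have X: "X i \<in> vector_fields A" for i
    unfolding X_def
  proof (rule chart_field[OF c(1) r(2) \<gamma>(1)])
    fix q assume "\<gamma> q \<noteq> 0"
    then show "q \<in> U \<and> \<phi> q \<in> cball a r" using \<gamma>(2)[of q] \<gamma>(4)[of q] by auto
  qed
  have XW: "X i q f = frechet_derivative (\<lambda>y. f (?i y)) (at (\<phi> q)) (axis i 1)"
    if "q \<in> W" "smooth_fun A f" for i q f
    using that \<gamma>(3)[of q] by (auto simp: X_def W_def s_def)
  have exp: "v f = (\<Sum>i\<in>UNIV. v (x i) * X i q f)"
    if q: "q \<in> W" and v: "v \<in> tangent_space A q" and f: "smooth_fun A f" for q v f
  proof -
    \<comment> \<open>\<open>tangent_coordinates\<close> indexes coordinates by basis vectors; the
      choice recovers the index i from \<open>axis i 1\<close>.\<close>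
    let ?x = "\<lambda>b. x (SOME i. b = axis i 1)"
    have ax: "(SOME j. axis i (1::real) = axis j 1) = i" for i :: 'n
      by (auto simp: axis_eq_axis)
    have "v f = (\<Sum>b\<in>Basis. v (?x b) * frechet_derivative (\<lambda>y. f (?i y)) (at (\<phi> q)) b)"
    proof (rule tangent_coordinates[OF c(1) W(1,2) q _ _ v f])
      fix b :: "real^'n" and q assume "b \<in> Basis" "q \<in> W"
      then obtain i where "b = axis i 1" by (auto simp: Basis_vec_def)
      then show "?x b q = \<phi> q \<bullet> b" using xW[OF \<open>q \<in> W\<close>] by (simp add: ax inner_axis)
    qed (rule x)
    then show ?thesis by (simp add: sum_Basis_axis ax XW q f)
  qed
  have homeo: "homeomorphism W (ball a s) \<phi> ?i"
    by (rule homeomorphism_of_subsets[OF chart_facts(4)[OF c(1)] W(2)])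
       (use im r in \<open>auto simp: s_def subset_iff\<close>)
  have "coordinate_ball A W \<phi> ?i a s X x"
  proof unfold_locales
    fix f :: "'m \<Rightarrow> real" assume "smooth_fun A f"
    then show "smooth_on (ball a s) (\<lambda>y. f (?i y))"
      by (rule smooth_on_subset[OF smooth_fun_chart[OF _ c(1)]]) (use im W in auto)
  qed (fact s W(1) homeo x xW X XW exp)+
  then show ?thesis
  proof (rule that[OF _ \<beta>(1,2)])
    show "\<beta> p > 0" using \<beta>(4) c s by (simp add: a_def)
    fix q assume "\<beta> q \<noteq> 0"
    then have "q \<in> U \<and> dist a (\<phi> q) < s / 2" using \<beta>(2)[of q] \<beta>(4)[of q] by auto
    then show "q \<in> ?i ` cball a (s/2)"
      using chart_facts(7)[OF c(1), of q] by (intro image_eqI[of q ?i "\<phi> q"]) auto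
  qed
qed

section \<open>Expansion of tangent vectors in the coordinate frame\<close>

context coordinate_ball
begin

lemma \<xi>\<eta> [simp]: "y \<in> ball a s \<Longrightarrow> \<xi> (\<eta> y) = y" "y \<in> ball a s \<Longrightarrow> \<eta> y \<in> W"
  and \<eta>\<xi> [simp]: "q \<in> W \<Longrightarrow> \<eta> (\<xi> q) = q" "q \<in> W \<Longrightarrow> \<xi> q \<in> ball a s"
  and continuous_\<xi>: "continuous_on W \<xi>" and continuous_\<eta>: "continuous_on (ball a s) \<eta>"
  using homeo unfolding homeomorphism_def by blast+

lemma rep_has_derivative:
  assumes "smooth_fun A f" "y \<in> ball a s"
  shows "((\<lambda>y. f (\<eta> y)) has_derivative (\<lambda>v. \<Sum>i\<in>UNIV. v $ i * X i (\<eta> y) f)) (at y)"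
proof -
  let ?D = "frechet_derivative (\<lambda>y. f (\<eta> y)) (at y)"
  have d: "((\<lambda>y. f (\<eta> y)) has_derivative ?D) (at y)"
    by (rule smooth_on_has_derivative[OF smooth_rep[OF assms(1)] assms(2)])
  have "?D v = (\<Sum>i\<in>UNIV. v $ i * X i (\<eta> y) f)" for v
    using linear_sum_Basis[OF has_derivative_linear[OF d], of v] assms
    by (simp add: sum_Basis_axis X_eq inner_axis)
  then have "?D = (\<lambda>v. \<Sum>i\<in>UNIV. v $ i * X i (\<eta> y) f)" ..
  then show ?thesis using d by simp
qed

lemma X_x: "q \<in> W \<Longrightarrow> X i q (x j) = (if i = j then 1 else 0)"
proof -
  assume q: "q \<in> W"
  have "((\<lambda>y. x j (\<eta> y)) has_derivative (\<lambda>v. v $ j)) (at (\<xi> q))"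
    by (rule has_derivative_transform_within_open[of "\<lambda>y. y $ j" _ _ UNIV "ball a s"])
       (use q in \<open>auto intro!: bounded_linear_imp_has_derivative bounded_linear_vec_nth
         simp: x_eq simp del: mem_ball\<close>)
  then show ?thesis
    by (simp add: X_eq[OF q x_smooth] frechet_derivative_eq axis_def)
qed

text \<open>On non-smooth f both sides are 0 by convention. So the expansion is an equality of
  functionals and may be substituted into the argument of a form.\<close>

lemma tangent_expansion_fun:
  assumes "q \<in> W" "v \<in> tangent_space A q"
  shows "v = (\<lambda>f. \<Sum>i\<in>UNIV. v (x i) * X i q f)"
proof
  fix f show "v f = (\<Sum>i\<in>UNIV. v (x i) * X i q f)"
  proof (cases "smooth_fun A f")
    case False
    then show ?thesis
      using tangent_non_smooth[OF assms(2) False]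
        tangent_non_smooth[OF vector_field_tangent[OF X_field] False] by simp
  qed (rule tangent_expansion[OF assms])
qed

lemma tangent_zero_at_extremum:
  assumes q: "q \<in> W" and v: "v \<in> tangent_space A q" and f: "smooth_fun A f"
    and max: "(\<forall>q'. f q' \<le> f q) \<or> (\<forall>q'. f q \<le> f q')"
  shows "v f = 0"
proof -
  have "frechet_derivative (\<lambda>y. f (\<eta> y)) (at (\<xi> q)) = (\<lambda>v. 0)"
    by (rule differential_zero_maxmin[OF _ open_ball[of a s]
          smooth_on_has_derivative[OF smooth_rep[OF f]]]) (use q max in \<open>auto simp del: mem_ball\<close>)
  then show ?thesis using tangent_expansion[OF q v f] by (simp add: X_eq[OF q f])
qed

end

section \<open>Parallel forms of a radiant structure\<close>

text \<open>Forms act on lists, matrices on indexed families. A duplicate-free enumeration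
  \<open>ixs\<close> matches an update at position m with an update at the index
  \<open>ixs ! m\<close>, and equal list entries with equal values of the family.\<close>

lemma alternating_family_of_list:
  fixes ixs :: "'n::finite list"
  assumes L: "alternating_multilinear k T L" and ixs: "distinct ixs" "set ixs = UNIV" "length ixs = k"
    and T: "\<And>u w a b. u \<in> T \<Longrightarrow> w \<in> T \<Longrightarrow> (\<lambda>f. a * u f + b * w f) \<in> T" "T \<noteq> {}"
  shows "alternating_family T (\<lambda>V. L (map V ixs))"
proof unfold_locales
  fix V :: "'n \<Rightarrow> ('a \<Rightarrow> real) \<Rightarrow> real" and i u w a b
  assume V: "range V \<subseteq> T" and u: "u \<in> T" "w \<in> T"
  obtain m where m: "m < k" "ixs ! m = i" using ixs by (metis UNIV_I in_set_conv_nth)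
  have upd: "map (V(i := z)) ixs = (map V ixs)[m := z]" for z
    by (rule nth_equalityI) (use m ixs in \<open>auto simp: nth_list_update nth_eq_iff_index_eq\<close>)
  have "L (vs[m := (\<lambda>f. a * u f + b * w f)]) = a * L (vs[m := u]) + b * L (vs[m := w])"
    if "vs \<in> lists T" "length vs = k" for vs
    using L that m(1) u unfolding alternating_multilinear_def by blast
  moreover have "map V ixs \<in> lists T" using V by (auto simp: in_lists_conv_set)
  ultimately show "L (map (V(i := (\<lambda>f. a * u f + b * w f))) ixs) = a * L (map (V(i := u)) ixs) + b * L (map (V(i := w)) ixs)"
    unfolding upd using ixs by auto
next
  fix V :: "'n \<Rightarrow> ('a \<Rightarrow> real) \<Rightarrow> real" and i j :: 'n
  assume V: "range V \<subseteq> T" and ij: "i \<noteq> j" "V i = V j"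
  obtain m where m: "m < k" "ixs ! m = i" using ixs by (metis UNIV_I in_set_conv_nth)
  obtain l where l: "l < k" "ixs ! l = j" using ixs by (metis UNIV_I in_set_conv_nth)
  have alt: "L vs = 0" if "vs \<in> lists T" "length vs = k" "i < j" "j < k" "vs ! i = vs ! j" for vs i j
    using L that unfolding alternating_multilinear_def by blast
  have "map V ixs \<in> lists T" "length (map V ixs) = k" using V ixs by (auto simp: in_lists_conv_set)
  then show "L (map V ixs) = 0"
    using alt[of "map V ixs" m l] alt[of "map V ixs" l m] m l ij ixs
    by (cases m l rule: linorder_cases) auto
qed (use T in auto)

context atlas_manifold
begin

lemma tangent_space_lin:
  "u \<in> tangent_space A p \<Longrightarrow> w \<in> tangent_space A p \<Longrightarrow> (\<lambda>f. a * u f + b * w f) \<in> tangent_space A p"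
  by (auto simp: tangent_space_def algebra_simps)

lemma tangent_space_nonempty: "tangent_space A p \<noteq> {}"
proof -
  have "(\<lambda>f. 0) \<in> tangent_space A p" by (simp add: tangent_space_def)
  then show ?thesis by blast
qed

lemma diff_form_alternating_family:
  assumes "diff_form A k \<omega>" "distinct ixs" "set ixs = (UNIV :: 'i::finite set)" "length ixs = k"
  shows "alternating_family (tangent_space A p) (\<lambda>V :: 'i \<Rightarrow> 'm tvec. \<omega> p (map V ixs))"
  by (rule alternating_family_of_list[OF _ assms(2-4) tangent_space_lin tangent_space_nonempty])
     (use assms(1) in \<open>auto simp: diff_form_def\<close>)

end

lemma parallel_one_form_zero:
  fixes A :: "('m::{t2_space,second_countable_topology}, real^'n::finite) chart set"
  assumes mfd: "smooth_manifold A" and cpt: "compact (UNIV :: 'm set)"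
    and rad: "radiant_structure A nabla E"
    and \<alpha>: "diff_form A 1 \<alpha>" "parallel_form A nabla 1 \<alpha>"
  shows "form_is_zero A 1 \<alpha>"
proof -
  interpret atlas_manifold A by unfold_locales (rule mfd)
  have E: "E \<in> vector_fields A" "\<And>X. X \<in> vector_fields A \<Longrightarrow> nabla X E = X"
    using rad by (auto simp: radiant_structure_def)
  define f where "f = form_eval \<alpha> [E]"
  have f: "smooth_fun A f" using \<alpha>(1) E by (auto simp: diff_form_def f_def)
  have df: "X p f = \<alpha> p [X p]" if X: "X \<in> vector_fields A" for X p
  proof -
    have "cov_deriv_form nabla X \<alpha> [E] p = 0" using \<alpha>(2) X E by (auto simp: parallel_form_def)
    then show ?thesis using E(2)[OF X] by (simp add: cov_deriv_form_def f_def form_eval_def)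
  qed
  have Ef: "E p f = f p" for p using df[OF E(1)] by (simp add: f_def form_eval_def)
  have crit: "f p = 0" if "(\<forall>q. f q \<le> f p) \<or> (\<forall>q. f p \<le> f q)" for p
  proof -
    obtain W \<xi> \<eta> a s X x \<beta> where c: "coordinate_ball A W \<xi> \<eta> a s X x"
      and "smooth_fun A \<beta>" "\<And>q. \<beta> q \<ge> 0"
      and \<beta>: "\<beta> p > 0" "\<And>q. \<beta> q \<noteq> 0 \<Longrightarrow> q \<in> \<eta> ` cball a (s / 2)"
      using coordinate_ball_exists[OF mfd, of p] by blast
    interpret coordinate_ball A W \<xi> \<eta> a s X x by (rule c)
    have "p \<in> W" using \<beta>(2)[of p] \<beta>(1) s_pos by auto
    then show ?thesis
      using tangent_zero_at_extremum[OF _ vector_field_tangent[OF E(1)] f that] Ef by simp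
  qed
  obtain p where p: "\<And>q. f q \<le> f p"
    using continuous_attains_sup[OF cpt _ smooth_fun_continuous[OF f]] by blast
  obtain p' where p': "\<And>q. f p' \<le> f q"
    using continuous_attains_inf[OF cpt _ smooth_fun_continuous[OF f]] by blast
  have "f = (\<lambda>q. 0)"
    using p p' crit[of p] crit[of p'] by (intro ext) (metis order_antisym)
  then have zero: "\<alpha> p [X p] = 0" if "X \<in> vector_fields A" for X p
    using df[OF that] tangent_const[OF vector_field_tangent[OF that]] by metis
  \<comment> \<open>So far \<alpha> is known to vanish on values of global fields; an arbitrary
    tangent vector at p is a combination of the values of the global fields
    \<open>X i\<close>.\<close>
  have "\<alpha> p [v] = 0" if v: "v \<in> tangent_space A p" for p v
  proof -
    obtain W \<xi> \<eta> a s X x \<beta> where c: "coordinate_ball A W \<xi> \<eta> a s X x"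
      and "smooth_fun A \<beta>" "\<And>q. \<beta> q \<ge> 0"
      and \<beta>: "\<beta> p > 0" "\<And>q. \<beta> q \<noteq> 0 \<Longrightarrow> q \<in> \<eta> ` cball a (s / 2)"
      using coordinate_ball_exists[OF mfd, of p] by blast
    interpret coordinate_ball A W \<xi> \<eta> a s X x by (rule c)
    have p: "p \<in> W" using \<beta>(2)[of p] \<beta>(1) s_pos by auto
    \<comment> \<open>A one-form is an alternating family over the one-element index type, which
      gives linearity over finite sums.\<close>
    interpret alternating_family "tangent_space A p" "\<lambda>V. \<alpha> p (map V [()])"
      by (rule diff_form_alternating_family[OF \<alpha>(1)]) (auto simp: UNIV_unit)
    have "\<alpha> p [v] = \<alpha> p [\<lambda>f. \<Sum>i\<in>UNIV. v (x i) * X i p f]"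
      using tangent_expansion_fun[OF p v] by simp
    also have "\<dots> = (\<Sum>i\<in>UNIV. v (x i) * \<alpha> p [X i p])"
      using update_sum[of "\<lambda>_. v" UNIV "\<lambda>i. X i p" "()" "\<lambda>i. v (x i)"] v
        vector_field_tangent[OF X_field] by auto
    finally show ?thesis using zero[OF X_field] by simp
  qed
  then show ?thesis by (auto simp: form_is_zero_def length_Suc_conv)
qed

locale frame_density = coordinate_ball A W \<xi> \<eta> a s X x
  for A :: "('m::{t2_space,second_countable_topology}, real^'n::finite) chart set"
    and W \<xi> \<eta> a s X x +
  fixes \<omega> :: "'m form" and ixs :: "'n list"
  assumes form: "diff_form A CARD('n) \<omega>" and ixs: "distinct ixs" "set ixs = UNIV"
begin

lemma length_ixs: "length ixs = CARD('n)"
  using distinct_card[OF ixs(1)] ixs(2) by simp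

text \<open>On W this is the coefficient of \<omega> in the coordinates; its absolute value is the
  density integrated below.\<close>

definition w :: "'m \<Rightarrow> real" where "w q = \<omega> q (map (\<lambda>i. X i q) ixs)"

lemma w_eq: "w = form_eval \<omega> (map X ixs)"
  by (auto simp: w_def form_eval_def o_def)

lemma w_smooth: "smooth_fun A w"
  using form X_field length_ixs unfolding w_eq diff_form_def by (auto simp: in_lists_conv_set)

sublocale family: alternating_family "tangent_space A p" "\<lambda>V. \<omega> p (map V ixs)" for p
  by (rule diff_form_alternating_family[OF form ixs length_ixs])

lemma X_tangent: "range (\<lambda>i. X i q) \<subseteq> tangent_space A q"
  using vector_field_tangent[OF X_field] by auto

text \<open>Torsion-freeness and nabla_X E = X give nabla_E X_i = X_i + [E, X_i]. Evaluated on x_i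
  at q this is 1 - X_i(E x_i), because X_i x_i is constant on W. By alternation only this component
  of nabla_E X_i counts in the i-th slot of \<omega>, and parallelism equates the sum over i with E
  w.\<close>

lemma w_derivative:
  fixes E :: "'m vfield"
  assumes rad: "radiant_structure A nabla E" and par: "parallel_form A nabla CARD('n) \<omega>" and q: "q \<in> W"
  shows "E q w = (real CARD('n) - (\<Sum>i\<in>UNIV. X i q (\<lambda>p. E p (x i)))) * w q"
proof -
  have E: "E \<in> vector_fields A" "\<And>X. X \<in> vector_fields A \<Longrightarrow> nabla X E = X"
    and closed: "\<And>X Y. X \<in> vector_fields A \<Longrightarrow> Y \<in> vector_fields A \<Longrightarrow> nabla X Y \<in> vector_fields A"
    and tor: "\<And>X Y. X \<in> vector_fields A \<Longrightarrow> Y \<in> vector_fields A \<Longrightarrow>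
      vf_diff (nabla X Y) (nabla Y X) = lie_bracket X Y"
    using rad by (auto simp: radiant_structure_def affine_connection_def torsion_free_def)
  let ?v = "\<lambda>i. nabla E (X i) q"
  have vT: "?v i \<in> tangent_space A q" for i
    by (rule vector_field_tangent[OF closed[OF E(1) X_field]])
  have vx: "?v i (x i) = 1 - X i q (\<lambda>p. E p (x i))" for i
  proof -
    have "?v i (x i) - X i q (x i) = E q (\<lambda>p. X i p (x i)) - X i q (\<lambda>p. E p (x i))"
      using fun_cong[OF fun_cong[OF tor[OF E(1) X_field[of i]]], of q "x i"] E(2)[OF X_field]
      by (simp add: vf_diff_def lie_bracket_def)
    \<comment> \<open>X_i x_i equals 1 only on W, so locality of the derivation \<open>E q\<close>
      is used.\<close>
    moreover have "E q (\<lambda>p. X i p (x i)) = E q (\<lambda>p. 1)"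
      by (rule tangent_local[OF vector_field_tangent[OF E(1)] _ _ open_W q])
         (simp_all add: vector_field_smooth X_field x_smooth X_x)
    ultimately show ?thesis
      by (simp add: X_x[OF q] tangent_const[OF vector_field_tangent[OF E(1)]])
  qed
  \<comment> \<open>Distinctness of \<open>ixs\<close> ensures that the update hits position k
    alone.\<close>
  have upd: "(map X ixs)[k := Y] = map (X(ixs ! k := Y)) ixs" if "k < length ixs" for k Y
    by (rule nth_equalityI) (use that ixs in \<open>auto simp: nth_list_update nth_eq_iff_index_eq\<close>)
  have summand: "form_eval \<omega> ((map X ixs)[k := nabla E (map X ixs ! k)]) q =
      (1 - X (ixs ! k) q (\<lambda>p. E p (x (ixs ! k)))) * w q" if k: "k < length ixs" for k
  proof -
    let ?i = "ixs ! k" and ?V = "\<lambda>i. X i q"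
    have "form_eval \<omega> ((map X ixs)[k := nabla E (map X ixs ! k)]) q = \<omega> q (map (?V(?i := ?v ?i)) ixs)"
      using k by (auto simp: upd form_eval_def intro!: arg_cong[of _ _ "\<omega> q"])
    also have "?v ?i = (\<lambda>f. \<Sum>j\<in>UNIV. ?v ?i (x j) * ?V j f)"
      by (rule tangent_expansion_fun[OF q vT])
    also have "\<omega> q (map (?V(?i := (\<lambda>f. \<Sum>j\<in>UNIV. ?v ?i (x j) * ?V j f))) ixs) = ?v ?i (x ?i) * w q"
      unfolding w_def by (rule family.update_combination[OF X_tangent])
    finally show ?thesis by (simp only: vx)
  qed
  have "cov_deriv_form nabla E \<omega> (map X ixs) q = 0"
    using par E X_field length_ixs by (auto simp: parallel_form_def in_lists_conv_set)
  then have "E q w = (\<Sum>k<length ixs. (1 - X (ixs ! k) q (\<lambda>p. E p (x (ixs ! k)))) * w q)"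
    by (simp add: cov_deriv_form_def w_eq[symmetric] summand cong: sum.cong_simp del: nth_map)
  also have "\<dots> = (\<Sum>i\<in>UNIV. (1 - X i q (\<lambda>p. E p (x i))) * w q)"
    using sum.reindex_bij_betw[OF bij_betw_nth[OF ixs(1) refl refl],
        of "\<lambda>i. (1 - X i q (\<lambda>p. E p (x i))) * w q"] ixs(2) by (simp add: lessThan_atLeast0)
  finally show ?thesis by (simp add: sum_subtractf flip: sum_distrib_right)
qed

text \<open>The left side is the Euclidean divergence of the field with components \<rho> (E x_i) w.
  The product rule yields w E \<rho> + \<rho> E w + \<rho> w \<Sum> X_i(E x_i), and inserting
  \<open>w_derivative\<close> for E w cancels the last sum and leaves n \<rho> w.\<close>

lemma divergence_identity:
  fixes E :: "'m vfield" and \<rho> :: "'m \<Rightarrow> real"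
  assumes rad: "radiant_structure A nabla E" and par: "parallel_form A nabla CARD('n) \<omega>" and q: "q \<in> W"
    and \<rho>: "smooth_fun A \<rho>"
  shows "(\<Sum>i\<in>UNIV. X i q (\<lambda>p. \<rho> p * (E p (x i) * w p))) = (E q \<rho> + real CARD('n) * \<rho> q) * w q"
proof -
  have E: "E \<in> vector_fields A" using rad by (auto simp: radiant_structure_def)
  have Ex: "smooth_fun A (\<lambda>p. E p (x i))" for i by (rule vector_field_smooth[OF E x_smooth])
  have XT: "X i q \<in> tangent_space A q" for i by (rule vector_field_tangent[OF X_field])
  have "(\<Sum>i\<in>UNIV. X i q (\<lambda>p. \<rho> p * (E p (x i) * w p))) =
    (\<Sum>i\<in>UNIV. \<rho> q * (E q (x i) * X i q w + w q * X i q (\<lambda>p. E p (x i))) + E q (x i) * w q * X i q \<rho>)"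
    by (simp add: tangent_mult[OF XT] smooth_fun_mult \<rho> Ex w_smooth)
  also have "\<dots> = \<rho> q * (\<Sum>i\<in>UNIV. E q (x i) * X i q w) + \<rho> q * w q * (\<Sum>i\<in>UNIV. X i q (\<lambda>p. E p (x i)))
      + w q * (\<Sum>i\<in>UNIV. E q (x i) * X i q \<rho>)"
    by (simp add: sum.distrib sum_distrib_left algebra_simps)
  also have "\<dots> = \<rho> q * E q w + \<rho> q * w q * (\<Sum>i\<in>UNIV. X i q (\<lambda>p. E p (x i))) + w q * E q \<rho>"
    using tangent_expansion[OF q vector_field_tangent[OF E]] \<rho> w_smooth by simp
  also have "\<dots> = (E q \<rho> + real CARD('n) * \<rho> q) * w q"
    by (simp add: w_derivative[OF rad par q] algebra_simps)
  finally show ?thesis .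
qed

text \<open>\<open>vs\<close> arises from the frame by the matrix of its components, so
  |\<omega>(vs)| = |det| |w|, and a zero of w would force \<omega>(vs) = 0.\<close>

lemma w_nonzero:
  assumes q: "q \<in> W" and vs: "vs \<in> lists (tangent_space A q)" "length vs = CARD('n)" "\<omega> q vs \<noteq> 0"
  shows "w q \<noteq> 0"
proof -
  define V where "V i = vs ! (THE k. k < length ixs \<and> ixs ! k = i)" for i
  have "V (ixs ! k) = vs ! k" if "k < length ixs" for k
    unfolding V_def using that ixs(1) by (auto intro!: arg_cong[of _ _ "(!) vs"] simp: nth_eq_iff_index_eq)
  then have V: "map V ixs = vs" using vs(2) length_ixs by (intro nth_equalityI) auto
  then have VT: "V i \<in> tangent_space A q" for i
    using vs(1) ixs(2) by (metis UNIV_I in_listsD list.set_map imageI)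
  let ?M = "(\<chi> i j. V i (x j)) :: real^'n^'n"
  have "apply_matrix ?M (\<lambda>i. X i q) = V"
    using tangent_expansion_fun[OF q VT] by (auto simp: apply_matrix_def)
  then have "\<bar>\<omega> q vs\<bar> = \<bar>det ?M\<bar> * \<bar>w q\<bar>"
    using family.abs_apply_matrix[OF X_tangent, of q ?M] V by (simp add: w_def)
  then show ?thesis using vs(3) by auto
qed

end

section \<open>Integration over coordinate balls\<close>

lemma extend_by_zero_continuous:
  fixes F :: "'a::euclidean_space \<Rightarrow> real"
  assumes "open B" "compact K" "K \<subseteq> B" "continuous_on B F" "\<And>y. y \<in> B \<Longrightarrow> y \<notin> K \<Longrightarrow> F y = 0"
  shows "continuous_on UNIV (\<lambda>y. if y \<in> B then F y else 0)"
proof -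
  let ?G = "\<lambda>y. if y \<in> B then F y else 0"
  have "continuous_on B ?G" using assms(4) by (simp cong: continuous_on_cong)
  moreover have "continuous_on (- K) ?G"
    by (rule continuous_on_eq[of _ "\<lambda>_. 0"]) (use assms(5) in auto)
  ultimately have "continuous_on (B \<union> - K) ?G"
    using assms(1,2) by (intro continuous_on_open_Un) (auto dest: compact_imp_closed)
  moreover have "B \<union> - K = UNIV" using assms(3) by auto
  ultimately show ?thesis by simp
qed

text \<open>The integral over the open ball suits the divergence argument, the one over the compact
  set suits the change of variables; extension by zero links them.\<close>

lemma compact_support_integral:
  fixes F :: "'a::euclidean_space \<Rightarrow> real"
  assumes "open B" "compact K" "K \<subseteq> B" "continuous_on B F" "\<And>y. y \<in> B \<Longrightarrow> y \<notin> K \<Longrightarrow> F y = 0"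
  shows "F absolutely_integrable_on B" "F absolutely_integrable_on K" "integral B F = integral K F"
proof -
  let ?G = "\<lambda>y. if y \<in> B then F y else 0"
  obtain c d where K: "K \<subseteq> cbox c d"
    using bounded_subset_cbox_symmetric[OF compact_imp_bounded[OF assms(2)]] by blast
  have "?G absolutely_integrable_on cbox c d"
    by (rule absolutely_integrable_continuous)
       (rule continuous_on_subset[OF extend_by_zero_continuous[OF assms]], auto)
  moreover have e: "{y \<in> UNIV - cbox c d. ?G y \<noteq> 0} = {}" "{y \<in> cbox c d - UNIV. ?G y \<noteq> 0} = {}"
    using K assms(5) by auto
  ultimately have "?G absolutely_integrable_on UNIV"
    using absolutely_integrable_spike_set_eq[of UNIV "cbox c d" ?G] by (simp only: e negligible_empty)
  then show B: "F absolutely_integrable_on B" by (simp only: absolutely_integrable_restrict_UNIV)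
  have e: "{y \<in> B - K. F y \<noteq> 0} = {}" "{y \<in> K - B. F y \<noteq> 0} = {}" using assms by auto
  show "F absolutely_integrable_on K"
    using absolutely_integrable_spike_set_eq[of B K F] B by (simp only: e negligible_empty)
  show "integral B F = integral K F"
    by (rule integral_spike_set) (simp_all only: e negligible_empty)
qed

text \<open>The integral of the translate G(y + t e) does not depend on t. Differentiating under the
  integral sign at t = 0 therefore gives 0, and it also gives the integral of D.\<close>

lemma integral_directional_derivative_zero:
  fixes G D :: "'a::euclidean_space \<Rightarrow> real"
  assumes der: "\<And>y. ((\<lambda>t. G (y + t *\<^sub>R e)) has_vector_derivative D y) (at 0)"
    and G: "continuous_on UNIV G" and D: "continuous_on UNIV D"
    and K: "compact K" "\<And>y. y \<notin> K \<Longrightarrow> G y = 0" "\<And>y. y \<notin> K \<Longrightarrow> D y = 0"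
  shows "integral K D = 0"
proof -
  obtain r where r: "\<And>y. y \<in> K \<Longrightarrow> norm y \<le> r"
    using compact_imp_bounded[OF K(1)] by (auto simp: bounded_iff)
  \<comment> \<open>A box large enough for the supports of all translates with |t| at most 1, so
    that moving the box along with G changes no integral.\<close>
  obtain c d where box: "cball 0 (r + norm e) \<subseteq> cbox c (d :: 'a)"
    using bounded_subset_cbox_symmetric[OF bounded_cball] by blast
  have inbox: "y \<in> cbox c d" if "y + t *\<^sub>R e \<in> K" "\<bar>t\<bar> \<le> 1" for y t
  proof -
    have "norm y \<le> norm (y + t *\<^sub>R e) + norm (t *\<^sub>R e)"
      using norm_triangle_ineq4[of "y + t *\<^sub>R e" "t *\<^sub>R e"] by simp
    also have "\<dots> \<le> r + norm e"
      using r[OF that(1)] mult_right_mono[OF that(2), of "norm e"] by simp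
    finally show ?thesis using box by (auto simp: subset_iff)
  qed
  have "integral (cbox c d) (\<lambda>y. G (y + t *\<^sub>R e)) = integral (cbox c d) G" if t: "t \<in> {-1<..<1}" for t
  proof -
    have "(G has_integral integral (cbox c d) G) (cbox c d)"
      by (intro integrable_integral integrable_continuous continuous_on_subset[OF G]) auto
    from has_integral_affinity[OF this, of 1 "t *\<^sub>R e"]
    have "integral ((\<lambda>y. y - t *\<^sub>R e) ` cbox c d) (\<lambda>y. G (y + t *\<^sub>R e)) = integral (cbox c d) G"
      by (simp add: integral_unique)
    moreover have "integral ((\<lambda>y. y - t *\<^sub>R e) ` cbox c d) (\<lambda>y. G (y + t *\<^sub>R e)) =
        integral (cbox c d) (\<lambda>y. G (y + t *\<^sub>R e))"
    proof (rule integral_spike_set)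
      have inK: "y + t *\<^sub>R e \<in> K" if "G (y + t *\<^sub>R e) \<noteq> 0" for y
        using K(2) that by blast
      have "y \<in> cbox c d" if "G (y + t *\<^sub>R e) \<noteq> 0" for y
        using inbox[OF inK[OF that]] t by auto
      then have "{y \<in> (\<lambda>y. y - t *\<^sub>R e) ` cbox c d - cbox c d. G (y + t *\<^sub>R e) \<noteq> 0} = {}" by auto
      then show "negligible {y \<in> (\<lambda>y. y - t *\<^sub>R e) ` cbox c d - cbox c d. G (y + t *\<^sub>R e) \<noteq> 0}"
        by (simp only: negligible_empty)
      have "y \<in> (\<lambda>y. y - t *\<^sub>R e) ` cbox c d" if "G (y + t *\<^sub>R e) \<noteq> 0" for y
        using inbox[of "y + t *\<^sub>R e" 0] inK[OF that] by (intro image_eqI[of _ _ "y + t *\<^sub>R e"]) auto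
      then have "{y \<in> cbox c d - (\<lambda>y. y - t *\<^sub>R e) ` cbox c d. G (y + t *\<^sub>R e) \<noteq> 0} = {}" by blast
      then show "negligible {y \<in> cbox c d - (\<lambda>y. y - t *\<^sub>R e) ` cbox c d. G (y + t *\<^sub>R e) \<noteq> 0}"
        by (simp only: negligible_empty)
    qed
    ultimately show ?thesis by simp
  qed
  then have d0: "((\<lambda>t. integral (cbox c d) (\<lambda>y. G (y + t *\<^sub>R e))) has_vector_derivative 0) (at 0)"
    by (intro has_vector_derivative_transform_within_open[OF has_vector_derivative_const, of "{-1<..<1}"])
       auto
  have d1: "((\<lambda>t. integral (cbox c d) (\<lambda>y. G (y + t *\<^sub>R e))) has_vector_derivative
      integral (cbox c d) (\<lambda>y. D (y + 0 *\<^sub>R e))) (at 0 within {-1<..<1})"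
  proof (rule leibniz_rule_vector_derivative)
    fix t y
    have "((\<lambda>h. G ((y + t *\<^sub>R e) + h *\<^sub>R e)) has_vector_derivative D (y + t *\<^sub>R e)) (at (t - t))"
      using der[of "y + t *\<^sub>R e"] by simp
    moreover have "((\<lambda>u. u - t) has_vector_derivative 1) (at t)"
      unfolding has_vector_derivative_def by (auto intro!: derivative_eq_intros)
    ultimately
    have "((\<lambda>u. G (y + t *\<^sub>R e + (u - t) *\<^sub>R e)) has_vector_derivative D (y + t *\<^sub>R e)) (at t)"
      using vector_diff_chain_at[of "\<lambda>u. u - t" 1 t] by (simp add: o_def)
    then show "((\<lambda>t. G (y + t *\<^sub>R e)) has_vector_derivative D (y + t *\<^sub>R e)) (at t within {-1<..<1})"
      by (simp add: algebra_simps has_vector_derivative_at_within)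
  next
    fix t show "(\<lambda>y. G (y + t *\<^sub>R e)) integrable_on cbox c d"
      by (intro integrable_continuous continuous_on_compose2[OF G] continuous_intros) auto
  next
    show "continuous_on ({-1<..<1} \<times> cbox c d) (\<lambda>(t, y). D (y + t *\<^sub>R e))"
      unfolding split_beta by (intro continuous_on_compose2[OF D] continuous_intros) auto
  qed auto
  have "at (0::real) within {-1<..<1} = at 0"
    by (rule at_within_open) auto
  then have "integral (cbox c d) D = 0"
    using vector_derivative_unique_at[OF _ d0] d1 by fastforce
  moreover have "integral (cbox c d) D = integral K D"
    using inbox[of _ 0] K(3)
    by (intro integral_spike_set empty_imp_negligible) auto
  ultimately show ?thesis by simp
qed

section \<open>Integrals of coordinate derivatives with compact support\<close>

context coordinate_ball
begin

text \<open>The compact set in which the bump function of \<open>coordinate_ball_exists\<close> is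
  supported.\<close>

definition L :: "'m set" where "L = \<eta> ` cball a (s / 2)"

lemma cball_subset: "cball a (s / 2) \<subseteq> ball a s"
  using s_pos by auto

lemma compact_L: "compact L"
  unfolding L_def by (rule compact_continuous_image[OF continuous_on_subset[OF continuous_\<eta> cball_subset]]) simp

lemma L_subset: "L \<subseteq> W"
  unfolding L_def using cball_subset \<xi>\<eta>(2) by blast

lemma \<eta>_in_L:
  assumes y: "y \<in> ball a s" shows "\<eta> y \<in> L \<longleftrightarrow> y \<in> cball a (s / 2)"
proof
  assume "\<eta> y \<in> L"
  then obtain y' where y': "y' \<in> cball a (s / 2)" "\<eta> y = \<eta> y'" unfolding L_def by blast
  then have "y = y'" using \<xi>\<eta>(1)[OF y] \<xi>\<eta>(1)[of y'] cball_subset by (metis subsetD)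
  then show "y \<in> cball a (s / 2)" using y' by simp
qed (auto simp: L_def)

text \<open>In coordinates \<open>X i\<close> is the i-th partial derivative and u has compact
  support in the ball; extended by zero, both functions satisfy the translation argument with e =
  \<open>axis i 1\<close>.\<close>

lemma integral_X_zero:
  assumes u: "smooth_fun A u" "\<And>q. q \<notin> L \<Longrightarrow> u q = 0"
  shows "integral (ball a s) (\<lambda>y. X i (\<eta> y) u) = 0"
proof -
  let ?K = "cball a (s / 2)"
  let ?G = "\<lambda>y. if y \<in> ball a s then u (\<eta> y) else 0"
  let ?D = "\<lambda>y. if y \<in> ball a s then X i (\<eta> y) u else 0"
  have Xu: "X i q u = 0" if "q \<notin> L" for q
    using tangent_local[OF vector_field_tangent[OF X_field] u(1) smooth_fun_const[of 0], of "- L" q i] that u(2)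
      compact_imp_closed[OF compact_L] tangent_const[OF vector_field_tangent[OF X_field]] by auto
  have outG: "u (\<eta> y) = 0" if "y \<in> ball a s" "y \<notin> ?K" for y
    using u(2)[of "\<eta> y"] \<eta>_in_L[OF that(1)] that by auto
  have outD: "X i (\<eta> y) u = 0" if "y \<in> ball a s" "y \<notin> ?K" for y
    using Xu[of "\<eta> y"] \<eta>_in_L[OF that(1)] that by auto
  have cG: "continuous_on (ball a s) (\<lambda>y. u (\<eta> y))"
    by (rule smooth_on_continuous[OF smooth_rep[OF u(1)]])
  have cD: "continuous_on (ball a s) (\<lambda>y. X i (\<eta> y) u)"
    by (rule smooth_on_continuous[OF smooth_rep[OF vector_field_smooth[OF X_field u(1)]]])
  have "integral ?K ?D = 0"
  proof (rule integral_directional_derivative_zero[where G = ?G and e = "axis i 1"])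
    show "continuous_on UNIV ?G"
      by (rule extend_by_zero_continuous[OF open_ball compact_cball cball_subset cG outG])
    show "continuous_on UNIV ?D"
      by (rule extend_by_zero_continuous[OF open_ball compact_cball cball_subset cD outD])
    fix y
    show "((\<lambda>t. ?G (y + t *\<^sub>R axis i 1)) has_vector_derivative ?D y) (at 0)"
    proof (cases "y \<in> ball a s")
      case True
      have "(?G has_derivative (\<lambda>v. \<Sum>j\<in>UNIV. v $ j * X j (\<eta> y) u)) (at y)"
        by (rule has_derivative_transform_within_open[OF rep_has_derivative[OF u(1) True] open_ball True]) auto
      moreover have "((\<lambda>t. y + t *\<^sub>R axis i 1) has_derivative (\<lambda>t. t *\<^sub>R axis i 1)) (at 0)"
        by (auto intro!: derivative_eq_intros)
      ultimately have "((\<lambda>t. ?G (y + t *\<^sub>R axis i 1)) has_derivative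
          (\<lambda>t. \<Sum>j\<in>UNIV. (t *\<^sub>R axis i 1) $ j * X j (\<eta> y) u)) (at 0)"
        by (intro has_derivative_compose[of "\<lambda>t. y + t *\<^sub>R axis i 1" _ 0 UNIV ?G]) simp_all
      moreover have "(\<Sum>j\<in>UNIV. (t *\<^sub>R axis i 1) $ j * X j (\<eta> y) u) = t * X i (\<eta> y) u" for t
      proof -
        have "(\<Sum>j\<in>UNIV. (t *\<^sub>R axis i 1) $ j * X j (\<eta> y) u) = (\<Sum>j\<in>UNIV. if j = i then t * X i (\<eta> y) u else 0)"
          by (rule sum.cong) (auto simp: axis_def)
        then show ?thesis by simp
      qed
      ultimately show ?thesis using True by (simp add: has_vector_derivative_def)
    next
      case False
      have z: "?G y = 0" if "y \<in> - ?K" for y using that outG by auto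
      have "((\<lambda>t. ?G (y + t *\<^sub>R axis i 1)) has_vector_derivative 0) (at 0)"
      proof (rule has_vector_derivative_transform_within_open[OF has_vector_derivative_const])
        show "open ((\<lambda>t. y + t *\<^sub>R axis i 1) -` (- ?K))"
          by (intro open_vimage continuous_intros) auto
        show "0 \<in> (\<lambda>t. y + t *\<^sub>R axis i (1::real)) -` (- ?K)" using False cball_subset by auto
      qed (use z in auto)
      then show ?thesis using False by simp
    qed
  qed (use outG outD in auto)
  also have "integral ?K ?D = integral ?K (\<lambda>y. X i (\<eta> y) u)"
    by (rule integral_cong) (use cball_subset in auto)
  finally show ?thesis
    using compact_support_integral(3)[OF open_ball compact_cball cball_subset cD outD] by simp
qed

end

section \<open>Integration against the density of the form\<close>

lemma change_of_variables_compact_real: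
  fixes f :: "real^'n::{finite,wellorder} \<Rightarrow> real" and g :: "real^'n::_ \<Rightarrow> real^'n::_"
  assumes "compact S" "\<And>y. y \<in> S \<Longrightarrow> (g has_derivative g' y) (at y within S)" "inj_on g S"
    and "f absolutely_integrable_on g ` S"
  shows "integral S (\<lambda>y. \<bar>det (matrix (g' y))\<bar> * f (g y)) = integral (g ` S) f"
proof -
  \<comment> \<open>The change of variables theorem concerns vector-valued integrands, so f is read
    as a map into \<open>real^1\<close>.\<close>
  have "integral S (\<lambda>y. \<bar>det (matrix (g' y))\<bar> *\<^sub>R (vec (f (g y)) :: real^1)) = vec (integral (g ` S) f)"
    using has_absolute_integral_change_of_variables_compact[OF assms(1-3),
        of "\<lambda>y. vec (f y) :: real^1" "vec (integral (g ` S) f)"] assms(4)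
    by (simp add: absolutely_integrable_on_1_iff integral_on_1_eq)
  then show ?thesis by (simp add: integral_on_1_eq)
qed

text \<open>Connectedness forbids a sign change, so c is 1 or -1. This turns the density |w| into c
  w, to which \<open>divergence_identity\<close> applies.\<close>

lemma nonzero_constant_sign:
  fixes f :: "'a::topological_space \<Rightarrow> real"
  assumes "connected S" "continuous_on S f" "\<And>y. y \<in> S \<Longrightarrow> f y \<noteq> 0"
  obtains c where "\<And>y. y \<in> S \<Longrightarrow> \<bar>f y\<bar> = c * f y"
proof (cases "\<exists>y\<in>S. f y < 0")
  case True
  then obtain u where u: "u \<in> S" "f u < 0" by blast
  have "\<bar>f y\<bar> = -1 * f y" if y: "y \<in> S" for y
  proof (rule ccontr)
    assume "\<not> ?thesis"
    then have "0 \<in> {f u..f y}" using u by auto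
    then have "0 \<in> f ` S"
      using connected_contains_Icc[OF connected_continuous_image[OF assms(2,1)], of "f u" "f y"] u y by auto
    then show False using assms(3) by auto
  qed
  then show ?thesis by (rule that)
next
  case False
  then show ?thesis by (intro that[of 1]) auto
qed

text \<open>The absolute value makes the integral insensitive to the orientation of the chart. The
  chart data are explicit parameters, so that the integrals of two coordinate balls can be
  compared.\<close>

definition frame_integral :: "(real^'n \<Rightarrow> 'm) \<Rightarrow> real^'n \<Rightarrow> real \<Rightarrow> ('n \<Rightarrow> 'm vfield) \<Rightarrow> 'm form \<Rightarrow>
    'n::finite list \<Rightarrow> ('m \<Rightarrow> real) \<Rightarrow> real" where
  "frame_integral \<eta> a s X \<omega> ixs h =
    integral (ball a s) (\<lambda>y. h (\<eta> y) * \<bar>\<omega> (\<eta> y) (map (\<lambda>i. X i (\<eta> y)) ixs)\<bar>)"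

context frame_density
begin

abbreviation J :: "('m \<Rightarrow> real) \<Rightarrow> real" where "J \<equiv> frame_integral \<eta> a s X \<omega> ixs"

lemma J_eq: "J h = integral (ball a s) (\<lambda>y. h (\<eta> y) * \<bar>w (\<eta> y)\<bar>)"
  by (simp add: frame_integral_def w_def)

lemma density_continuous:
  assumes "continuous_on UNIV h"
  shows "continuous_on (ball a s) (\<lambda>y. h (\<eta> y) * \<bar>w (\<eta> y)\<bar>)"
  by (intro continuous_intros continuous_on_compose2[OF assms continuous_\<eta>]
        continuous_on_compose2[OF smooth_fun_continuous[OF w_smooth] continuous_\<eta>]) auto

lemma \<xi>_image:
  assumes "compact K" "K \<subseteq> W"
  shows "compact (\<xi> ` K)" "\<xi> ` K \<subseteq> ball a s" "\<And>y. y \<in> ball a s \<Longrightarrow> y \<notin> \<xi> ` K \<Longrightarrow> \<eta> y \<notin> K"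
proof -
  show "compact (\<xi> ` K)"
    by (rule compact_continuous_image[OF continuous_on_subset[OF continuous_\<xi> assms(2)] assms(1)])
  show "\<xi> ` K \<subseteq> ball a s" using assms(2) \<eta>\<xi>(2) by blast
  show "\<eta> y \<notin> K" if "y \<in> ball a s" "y \<notin> \<xi> ` K" for y
    using \<xi>\<eta>(1)[OF that(1)] that(2) by (metis imageI)
qed

lemma J_compact:
  assumes h: "continuous_on UNIV h" "\<And>q. q \<notin> K \<Longrightarrow> h q = 0" and K: "compact K" "K \<subseteq> W"
  shows "(\<lambda>y. h (\<eta> y) * \<bar>w (\<eta> y)\<bar>) absolutely_integrable_on ball a s"
    "(\<lambda>y. h (\<eta> y) * \<bar>w (\<eta> y)\<bar>) absolutely_integrable_on \<xi> ` K"
    "J h = integral (\<xi> ` K) (\<lambda>y. h (\<eta> y) * \<bar>w (\<eta> y)\<bar>)"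
proof -
  have z: "h (\<eta> y) * \<bar>w (\<eta> y)\<bar> = 0" if "y \<in> ball a s" "y \<notin> \<xi> ` K" for y
    using \<xi>_image(3)[OF K that] h(2) by simp
  note * = compact_support_integral[OF open_ball \<xi>_image(1,2)[OF K] density_continuous[OF h(1)] z]
  show "(\<lambda>y. h (\<eta> y) * \<bar>w (\<eta> y)\<bar>) absolutely_integrable_on ball a s"
    "(\<lambda>y. h (\<eta> y) * \<bar>w (\<eta> y)\<bar>) absolutely_integrable_on \<xi> ` K"
    "J h = integral (\<xi> ` K) (\<lambda>y. h (\<eta> y) * \<bar>w (\<eta> y)\<bar>)"
    using * by (auto simp: J_eq)
qed

lemma J_sum:
  assumes "finite I" "\<And>i. i \<in> I \<Longrightarrow> continuous_on UNIV (h i)" "\<And>i q. i \<in> I \<Longrightarrow> q \<notin> L \<Longrightarrow> h i q = 0"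
  shows "J (\<lambda>q. \<Sum>i\<in>I. h i q) = (\<Sum>i\<in>I. J (h i))"
  unfolding J_eq sum_distrib_right
  by (rule integral_sum)
     (use J_compact(1)[OF _ _ compact_L L_subset] assms in \<open>auto simp: absolutely_integrable_on_def\<close>)

lemma J_nonneg: "(\<And>q. h q \<ge> 0) \<Longrightarrow> J h \<ge> 0"
  unfolding J_eq
  \<comment> \<open>A non-integrable integrand has integral 0 by convention.\<close>
  by (cases "(\<lambda>y. h (\<eta> y) * \<bar>w (\<eta> y)\<bar>) integrable_on ball a s")
     (auto intro!: integral_nonneg simp: not_integrable_integral)

text \<open>A nonnegative continuous function on a box with integral 0 vanishes; it is applied to h
  |w| extended by zero, and w has no zeros on W.\<close>

lemma J_zero_imp_zero:
  assumes h: "continuous_on UNIV h" "\<And>q. q \<notin> L \<Longrightarrow> h q = 0" "\<And>q. h q \<ge> 0" and J0: "J h = 0"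
    and nz: "\<And>q. q \<in> W \<Longrightarrow> w q \<noteq> 0"
  shows "h q = 0"
proof (cases "q \<in> L")
  case True
  then have q: "q \<in> W" using L_subset by blast
  let ?F = "\<lambda>y. h (\<eta> y) * \<bar>w (\<eta> y)\<bar>"
  let ?G = "\<lambda>y. if y \<in> ball a s then ?F y else 0"
  obtain c d where box: "cball a s \<subseteq> cbox c d"
    using bounded_subset_cbox_symmetric[OF bounded_cball] by blast
  have sub: "ball a s \<subseteq> cbox c d" using box by auto
  have z: "?F y = 0" if "y \<in> ball a s" "y \<notin> \<xi> ` L" for y
    using \<xi>_image(3)[OF compact_L L_subset that] h(2) by simp
  have "?G (\<xi> q) = 0"
  proof (rule has_integral_0_cbox_imp_0[of c d ?G])
    show "continuous_on (cbox c d) ?G"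
      by (rule continuous_on_subset[OF extend_by_zero_continuous[OF open_ball
              \<xi>_image(1,2)[OF compact_L L_subset] density_continuous[OF h(1)] z]]) auto
    show "0 \<le> ?G y" for y using h(3) by simp
    have "(?F has_integral 0) (ball a s)"
      using J_compact(1)[OF h(1,2) compact_L L_subset] J0
      by (auto simp: J_eq absolutely_integrable_on_def has_integral_iff)
    then show "(?G has_integral 0) (cbox c d)" by (simp only: has_integral_restrict[OF sub])
    have "ball a s \<subseteq> box c d" using interior_mono[OF box] by simp
    then show "box c d \<noteq> {}" using s_pos by (metis centre_in_ball empty_iff subset_empty)
    show "\<xi> q \<in> cbox c d" using \<eta>\<xi>(2)[OF q] sub by blast
  qed
  then show ?thesis using q nz[OF q] \<eta>\<xi>[OF q] by (simp del: mem_ball)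
qed (rule h(2))

text \<open>With |w| = c w on the ball, the integrand is c times a sum of partial derivatives of the
  functions \<rho> (E x_i) w, each supported in \<open>L\<close>.\<close>

lemma J_divergence_zero:
  fixes E :: "'m vfield" and \<rho> :: "'m \<Rightarrow> real"
  assumes rad: "radiant_structure A nabla E" and par: "parallel_form A nabla CARD('n) \<omega>"
    and \<rho>: "smooth_fun A \<rho>" "\<And>q. q \<notin> L \<Longrightarrow> \<rho> q = 0" and nz: "\<And>q. q \<in> W \<Longrightarrow> w q \<noteq> 0"
  shows "J (\<lambda>q. E q \<rho> + real CARD('n) * \<rho> q) = 0"
proof -
  have E: "E \<in> vector_fields A" using rad by (auto simp: radiant_structure_def)
  have cw: "continuous_on (ball a s) (\<lambda>y. w (\<eta> y))"
    by (rule smooth_on_continuous[OF smooth_rep[OF w_smooth]])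
  obtain c where c: "\<And>y. y \<in> ball a s \<Longrightarrow> \<bar>w (\<eta> y)\<bar> = c * w (\<eta> y)"
    using nonzero_constant_sign[OF connected_ball cw] nz \<xi>\<eta>(2) by metis
  let ?u = "\<lambda>i p. \<rho> p * (E p (x i) * w p)"
  have u: "smooth_fun A (?u i)" "\<And>q. q \<notin> L \<Longrightarrow> ?u i q = 0" for i
    by (intro smooth_fun_mult \<rho> vector_field_smooth[OF E] x_smooth w_smooth) (simp add: \<rho>)
  have Xu: "X i q (?u i) = 0" if "q \<notin> L" for i q
    using tangent_local[OF vector_field_tangent[OF X_field] u(1) smooth_fun_const[of 0], of "- L" q i] that u(2)
      compact_imp_closed[OF compact_L] tangent_const[OF vector_field_tangent[OF X_field]] by auto
  have int: "(\<lambda>y. X i (\<eta> y) (?u i)) integrable_on ball a s" for i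
  proof -
    have "(\<lambda>y. X i (\<eta> y) (?u i)) absolutely_integrable_on ball a s"
      by (rule compact_support_integral(1)[OF open_ball \<xi>_image(1,2)[OF compact_L L_subset]
            smooth_on_continuous[OF smooth_rep[OF vector_field_smooth[OF X_field u(1)]]]])
         (use Xu \<xi>_image(3)[OF compact_L L_subset] in blast)
    then show ?thesis by (simp add: absolutely_integrable_on_def)
  qed
  have "J (\<lambda>q. E q \<rho> + real CARD('n) * \<rho> q) = integral (ball a s) (\<lambda>y. c * (\<Sum>i\<in>UNIV. X i (\<eta> y) (?u i)))"
    unfolding J_eq
  proof (rule integral_cong)
    fix y assume y: "y \<in> ball a s"
    show "(E (\<eta> y) \<rho> + real CARD('n) * \<rho> (\<eta> y)) * \<bar>w (\<eta> y)\<bar> = c * (\<Sum>i\<in>UNIV. X i (\<eta> y) (?u i))"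
      unfolding divergence_identity[OF rad par \<xi>\<eta>(2)[OF y] \<rho>(1)] c[OF y] by (simp add: algebra_simps)
  qed
  also have "\<dots> = c * (\<Sum>i\<in>UNIV. integral (ball a s) (\<lambda>y. X i (\<eta> y) (?u i)))"
    by (simp add: integral_sum[OF finite int])
  also have "\<dots> = 0"
    using integral_X_zero[OF u] by simp
  finally show ?thesis .
qed

end

text \<open>Change of variables along the transition map \<xi>' \<circ> \<eta> on \<xi>(K). The
  numbers X_i(x'_k) are both the entries of its Jacobian matrix and the components of the first
  frame in the second, so the densities differ exactly by |det|.\<close>

lemma frame_integral_eq:
  fixes A :: "('m::{t2_space,second_countable_topology}, real^'n::{finite,wellorder}) chart set"
  assumes "frame_density A W \<xi> \<eta> a s X x \<omega> ixs" "frame_density A W' \<xi>' \<eta>' a' s' X' x' \<omega> ixs"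
    and h: "continuous_on UNIV h" "\<And>q. q \<notin> K \<Longrightarrow> h q = 0" and K: "compact K" "K \<subseteq> W" "K \<subseteq> W'"
  shows "frame_integral \<eta> a s X \<omega> ixs h = frame_integral \<eta>' a' s' X' \<omega> ixs h"
proof -
  interpret I: frame_density A W \<xi> \<eta> a s X x \<omega> ixs by (rule assms)
  interpret I': frame_density A W' \<xi>' \<eta>' a' s' X' x' \<omega> ixs by (rule assms)
  let ?g = "\<lambda>y. \<xi>' (\<eta> y)"
  let ?g' = "\<lambda>y v. (\<chi> k. \<Sum>i\<in>UNIV. v $ i * X i (\<eta> y) (x' k)) :: real^'n::_"
  let ?S = "\<xi> ` K"
  let ?f = "\<lambda>y. h (\<eta>' y) * \<bar>I'.w (\<eta>' y)\<bar>"
  have gS: "?g ` ?S = \<xi>' ` K" using K by (force simp: image_iff)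
  have inj: "inj_on ?g ?S"
    using K by (intro inj_onI) (metis I'.\<eta>\<xi>(1) I.\<eta>\<xi>(1) imageE subsetD)
  have der: "(?g has_derivative ?g' y) (at y within ?S)" if y: "y \<in> ?S" for y
    unfolding has_derivative_componentwise_within[of ?g]
  proof
    fix b :: "real^'n::_" assume "b \<in> Basis"
    then obtain k where k: "b = axis k 1" by (auto simp: Basis_vec_def)
    have yb: "y \<in> ball a s" using y I.\<xi>_image(2)[OF K(1,2)] by blast
    have "((\<lambda>y. x' k (\<eta> y)) has_derivative (\<lambda>v. \<Sum>i\<in>UNIV. v $ i * X i (\<eta> y) (x' k))) (at y within ?S)"
      by (rule has_derivative_at_withinI[OF I.rep_has_derivative[OF I'.x_smooth yb]])
    then have "((\<lambda>y. \<xi>' (\<eta> y) $ k) has_derivative (\<lambda>v. \<Sum>i\<in>UNIV. v $ i * X i (\<eta> y) (x' k))) (at y within ?S)"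
      by (rule has_derivative_transform[OF y, rotated]) (use K in \<open>auto simp: I'.x_eq subset_iff\<close>)
    then show "((\<lambda>y. ?g y \<bullet> b) has_derivative (\<lambda>v. ?g' y v \<bullet> b)) (at y within ?S)"
      by (simp add: k inner_axis)
  qed
  have K': "\<eta> y \<in> W'" if "y \<in> ?S" for y using that K by (auto simp: subset_iff)
  have jac: "\<bar>I.w (\<eta> y)\<bar> = \<bar>det (matrix (?g' y))\<bar> * \<bar>I'.w (\<eta> y)\<bar>" if y: "y \<in> ?S" for y
  proof -
    let ?q = "\<eta> y"
    have q: "?q \<in> W'" by (rule K'[OF y])
    let ?M = "(\<chi> i k. X i ?q (x' k)) :: real^'n::_^'n::_"
    have "apply_matrix ?M (\<lambda>i. X' i ?q) = (\<lambda>i. X i ?q)"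
      using I'.tangent_expansion_fun[OF q I.vector_field_tangent[OF I.X_field]]
      by (auto simp: apply_matrix_def)
    then have "\<bar>I.w ?q\<bar> = \<bar>det ?M\<bar> * \<bar>I'.w ?q\<bar>"
      using I.family.abs_apply_matrix[OF I'.X_tangent, of ?q ?M] by (simp add: I.w_def I'.w_def)
    \<comment> \<open>\<open>?M\<close> lists the components of \<open>X i\<close> in row i, while
      the Jacobian has them in column i.\<close>
    moreover have "matrix (?g' y) = transpose ?M"
      by (simp add: matrix_def transpose_def vec_eq_iff axis_def if_distrib[of "\<lambda>t. t * _"] cong: if_cong)
    ultimately show ?thesis by (simp add: det_transpose)
  qed
  have "frame_integral \<eta> a s X \<omega> ixs h = integral ?S (\<lambda>y. h (\<eta> y) * \<bar>I.w (\<eta> y)\<bar>)"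
    by (rule I.J_compact(3)[OF h K(1,2)])
  also have "\<dots> = integral ?S (\<lambda>y. \<bar>det (matrix (?g' y))\<bar> * ?f (?g y))"
    by (rule integral_cong) (use K in \<open>auto simp: jac subset_iff\<close>)
  also have "\<dots> = integral (?g ` ?S) ?f"
    by (rule change_of_variables_compact_real[OF I.\<xi>_image(1)[OF K(1,2)] der inj])
       (use I'.J_compact(2)[OF h K(1,3)] gS in simp_all)
  also have "\<dots> = frame_integral \<eta>' a' s' X' \<omega> ixs h"
    unfolding gS by (rule I'.J_compact(3)[OF h K(1,3), symmetric])
  finally show ?thesis .
qed

section \<open>No parallel volume form\<close>

lemma no_parallel_volume_form:
  fixes A :: "('m::{t2_space,second_countable_topology}, real^'n::{finite,wellorder}) chart set"
    and nabla :: "'m vfield \<Rightarrow> 'm vfield \<Rightarrow> 'm vfield" and E :: "'m vfield"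
  assumes mfd: "smooth_manifold A" and cpt: "compact (UNIV :: 'm set)"
    and rad: "radiant_structure A nabla E"
    and vol: "volume_form A \<omega>" and par: "parallel_form A nabla CARD('n) \<omega>"
  shows False
proof -
  interpret atlas_manifold A by unfold_locales (rule mfd)
  have form: "diff_form A CARD('n) \<omega>"
    and nondeg: "\<And>q. \<exists>vs\<in>lists (tangent_space A q). length vs = CARD('n) \<and> \<omega> q vs \<noteq> 0"
    using vol by (auto simp: volume_form_def)
  have E: "E \<in> vector_fields A" using rad by (auto simp: radiant_structure_def)
  obtain ixs :: "'n list" where ixs: "set ixs = UNIV" "distinct ixs"
    using finite_distinct_list[of "UNIV :: 'n set"] by auto
  \<comment> \<open>The quantifier hides the chart data, so that choosing a frame for every point
    yields just \<open>W\<close>, \<open>L\<close>, \<open>J\<close> and the bump functions; the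
    facts below reopen the locale for one point at a time.\<close>
  define is_frame where "is_frame W L J \<longleftrightarrow> (\<exists>\<xi> \<eta> a s X x. frame_density A W \<xi> \<eta> a s X x \<omega> ixs \<and>
      L = \<eta> ` cball a (s / 2) \<and> J = frame_integral \<eta> a s X \<omega> ixs)" for W L J
  have "\<exists>W L J \<beta>. is_frame W L J \<and> smooth_fun A \<beta> \<and> (\<forall>q. \<beta> q \<ge> 0) \<and> \<beta> p > 0 \<and> (\<forall>q. \<beta> q \<noteq> 0 \<longrightarrow> q \<in> L)" for p
  proof -
    obtain W \<xi> \<eta> a s X x \<beta> where c: "coordinate_ball A W \<xi> \<eta> a s X x" and \<beta>: "smooth_fun A \<beta>" "\<And>q. \<beta> q \<ge> 0"
      "\<beta> p > 0" "\<And>q. \<beta> q \<noteq> 0 \<Longrightarrow> q \<in> \<eta> ` cball a (s / 2)"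
      using coordinate_ball_exists[OF mfd, of p] by blast
    have "frame_density A W \<xi> \<eta> a s X x \<omega> ixs"
      using c form ixs by (auto simp: frame_density_def frame_density_axioms_def)
    then have "is_frame W (\<eta> ` cball a (s / 2)) (frame_integral \<eta> a s X \<omega> ixs)"
      unfolding is_frame_def by blast
    with \<beta> show ?thesis by blast
  qed
  then obtain W L J \<beta> where frame: "\<And>p. is_frame (W p) (L p) (J p)" and \<beta>: "\<And>p. smooth_fun A (\<beta> p)"
    "\<And>p q. \<beta> p q \<ge> 0" "\<And>p. \<beta> p p > 0" "\<And>p q. \<beta> p q \<noteq> 0 \<Longrightarrow> q \<in> L p"
    by metis
  have L: "compact (L p)" "L p \<subseteq> W p" for p
  proof -
    obtain \<xi> \<eta> a s X x where *: "frame_density A (W p) \<xi> \<eta> a s X x \<omega> ixs" "L p = \<eta> ` cball a (s / 2)"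
      using frame[of p] unfolding is_frame_def by blast
    interpret frame_density A "W p" \<xi> \<eta> a s X x \<omega> ixs by (rule *)
    show "compact (L p)" "L p \<subseteq> W p" using compact_L L_subset *(2) by (simp_all add: L_def)
  qed
  have J_sum: "J p (\<lambda>q. \<Sum>i\<in>I. h i q) = (\<Sum>i\<in>I. J p (h i))"
    if "finite I" "\<And>i. i \<in> I \<Longrightarrow> continuous_on UNIV (h i)" "\<And>i q. i \<in> I \<Longrightarrow> q \<notin> L p \<Longrightarrow> h i q = 0"
    for p and I :: "'m set" and h
  proof -
    obtain \<xi> \<eta> a s X x where *: "frame_density A (W p) \<xi> \<eta> a s X x \<omega> ixs" "L p = \<eta> ` cball a (s / 2)"
      "J p = frame_integral \<eta> a s X \<omega> ixs"
      using frame[of p] unfolding is_frame_def by blast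
    interpret frame_density A "W p" \<xi> \<eta> a s X x \<omega> ixs by (rule *)
    show ?thesis using J_sum[of I h] that *(2,3) by (simp add: L_def)
  qed
  have J_pos: "J p h \<ge> 0" "J p h = 0 \<Longrightarrow> h q = 0"
    if "continuous_on UNIV h" "\<And>q. q \<notin> L p \<Longrightarrow> h q = 0" "\<And>q. h q \<ge> 0" for p q h
  proof -
    obtain \<xi> \<eta> a s X x where *: "frame_density A (W p) \<xi> \<eta> a s X x \<omega> ixs" "L p = \<eta> ` cball a (s / 2)"
      "J p = frame_integral \<eta> a s X \<omega> ixs"
      using frame[of p] unfolding is_frame_def by blast
    interpret frame_density A "W p" \<xi> \<eta> a s X x \<omega> ixs by (rule *)
    have nz: "w q \<noteq> 0" if "q \<in> W p" for q using nondeg[of q] w_nonzero[OF that] by blast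
    show "J p h \<ge> 0" using J_nonneg[of h] that(3) *(3) by simp
    show "J p h = 0 \<Longrightarrow> h q = 0"
      using J_zero_imp_zero[of h q] nz that *(2,3) by (simp add: L_def)
  qed
  have J_div: "J p (\<lambda>q. E q \<rho> + real CARD('n) * \<rho> q) = 0"
    if "smooth_fun A \<rho>" "\<And>q. q \<notin> L p \<Longrightarrow> \<rho> q = 0" for p and \<rho> :: "'m \<Rightarrow> real"
  proof -
    obtain \<xi> \<eta> a s X x where *: "frame_density A (W p) \<xi> \<eta> a s X x \<omega> ixs" "L p = \<eta> ` cball a (s / 2)"
      "J p = frame_integral \<eta> a s X \<omega> ixs"
      using frame[of p] unfolding is_frame_def by blast
    interpret frame_density A "W p" \<xi> \<eta> a s X x \<omega> ixs by (rule *)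
    have nz: "w q \<noteq> 0" if "q \<in> W p" for q using nondeg[of q] w_nonzero[OF that] by blast
    show ?thesis using J_divergence_zero[OF rad par that(1)] nz that(2) *(2,3) by (simp add: L_def)
  qed
  have J_eq: "J p h = J p' h"
    if "continuous_on UNIV h" "\<And>q. q \<notin> L p \<Longrightarrow> h q = 0" "\<And>q. q \<notin> L p' \<Longrightarrow> h q = 0" for p p' h
  proof -
    obtain \<xi> \<eta> a s X x where *: "frame_density A (W p) \<xi> \<eta> a s X x \<omega> ixs"
      "J p = frame_integral \<eta> a s X \<omega> ixs"
      using frame[of p] unfolding is_frame_def by blast
    obtain \<xi>' \<eta>' a' s' X' x' where fr': "frame_density A (W p') \<xi>' \<eta>' a' s' X' x' \<omega> ixs"
      "J p' = frame_integral \<eta>' a' s' X' \<omega> ixs"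
      using frame[of p'] unfolding is_frame_def by blast
    have "compact (L p \<inter> L p')"
      using L(1)[of p] L(1)[of p'] by (intro compact_Int_closed compact_imp_closed)
    then show ?thesis
      unfolding *(2) fr'(2)
      by (rule frame_integral_eq[OF *(1) fr'(1) that(1), rotated])
        (use that L(2)[of p] L(2)[of p'] in auto)
  qed
  have "open {q. \<beta> p q > 0}" for p
    by (intro open_Collect_less continuous_on_const smooth_fun_continuous \<beta>)
  moreover have "UNIV \<subseteq> (\<Union>p\<in>UNIV. {q. \<beta> p q > 0})" using \<beta>(3) by auto
  ultimately obtain I where I: "finite I" "UNIV \<subseteq> (\<Union>p\<in>I. {q. \<beta> p q > 0})"
    using compactE_image[OF cpt, of UNIV "\<lambda>p. {q. \<beta> p q > 0}"] by metis
  define S where "S q = (\<Sum>p\<in>I. \<beta> p q)" for q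
  have S: "S q > 0" for q
  proof -
    obtain p where "p \<in> I" "\<beta> p q > 0" using I(2) by blast
    then show ?thesis unfolding S_def using I(1) \<beta>(2) by (intro sum_pos2) auto
  qed
  define \<rho> where "\<rho> p q = \<beta> p q * inverse (S q)" for p q
  have \<rho>: "smooth_fun A (\<rho> p)" "\<rho> p q \<ge> 0" "q \<notin> L p \<Longrightarrow> \<rho> p q = 0" for p q
  proof -
    show "smooth_fun A (\<rho> p)"
      unfolding \<rho>_def S_def
      by (intro smooth_fun_mult \<beta> smooth_fun_inverse smooth_fun_sum) (use S in \<open>simp add: S_def less_le\<close>)
    show "\<rho> p q \<ge> 0" using \<beta>(2) S[of q] by (simp add: \<rho>_def)
    show "q \<notin> L p \<Longrightarrow> \<rho> p q = 0" using \<beta>(4)[of p q] by (auto simp: \<rho>_def)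
  qed
  have sum_\<rho>: "(\<Sum>p\<in>I. \<rho> p q) = 1" for q
    using S[of q] by (simp add: \<rho>_def S_def flip: sum_distrib_right)
  have c\<rho>: "continuous_on UNIV (\<rho> p)" for p by (rule smooth_fun_continuous[OF \<rho>(1)])
  let ?n = "real CARD('n)"
  \<comment> \<open>\<open>h p\<close> is the divergence of \<rho>_p E with respect to the
    form.\<close>
  define h where "h p q = E q (\<rho> p) + ?n * \<rho> p q" for p q
  have h: "continuous_on UNIV (h p)" "q \<notin> L p \<Longrightarrow> h p q = 0" for p q
  proof -
    show "continuous_on UNIV (h p)"
      unfolding h_def by (intro smooth_fun_continuous smooth_fun_add smooth_fun_mult smooth_fun_const
        vector_field_smooth[OF E] \<rho>)
    assume q: "q \<notin> L p"
    have "E q (\<rho> p) = E q (\<lambda>q. 0)"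
      by (rule tangent_local[OF vector_field_tangent[OF E] \<rho>(1) smooth_fun_const, of "- L p"])
         (use q \<rho>(3) compact_imp_closed[OF L(1)] in auto)
    then show "h p q = 0" using q \<rho>(3) by (simp add: h_def tangent_const[OF vector_field_tangent[OF E]])
  qed
  have sum_h: "(\<Sum>p\<in>I. h p q) = ?n" for q
  proof -
    \<comment> \<open>The derivatives of the members add up to E(1) = 0, so only the dimension
      remains.\<close>
    have "(\<Sum>p\<in>I. E q (\<rho> p)) = E q (\<lambda>q. \<Sum>p\<in>I. \<rho> p q)"
      by (rule tangent_sum[OF vector_field_tangent[OF E] \<rho>(1), symmetric])
    then have "(\<Sum>p\<in>I. E q (\<rho> p)) = 0"
      by (simp add: sum_\<rho> tangent_const[OF vector_field_tangent[OF E]])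
    then show ?thesis by (simp add: h_def sum.distrib sum_\<rho> flip: sum_distrib_left)
  qed
  \<comment> \<open>The piece \<rho>_j h_i is supported in both \<open>L i\<close> and
    \<open>L j\<close>, so \<open>J j\<close> may be replaced by \<open>J i\<close>, whose value on
    \<Sum>_j \<rho>_j h_i = h_i is 0. Summing over i first instead, inside \<open>J j\<close>, turns
    the h_i into the constant n.\<close>
  have "(\<Sum>j\<in>I. J j (\<lambda>q. \<rho> j q * h i q)) = 0" for i
  proof -
    have "(\<Sum>j\<in>I. J j (\<lambda>q. \<rho> j q * h i q)) = (\<Sum>j\<in>I. J i (\<lambda>q. \<rho> j q * h i q))"
      by (intro sum.cong refl J_eq continuous_intros c\<rho> h) (simp_all add: \<rho> h)
    also have "\<dots> = J i (\<lambda>q. \<Sum>j\<in>I. \<rho> j q * h i q)"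
      by (rule J_sum[symmetric]) (auto intro!: continuous_intros c\<rho> h I simp: h)
    also have "\<dots> = J i (h i)" by (simp add: sum_\<rho> flip: sum_distrib_right)
    also have "\<dots> = 0" unfolding h_def by (rule J_div[OF \<rho>(1,3)])
    finally show ?thesis .
  qed
  then have "0 = (\<Sum>i\<in>I. \<Sum>j\<in>I. J j (\<lambda>q. \<rho> j q * h i q))" by simp
  also have "\<dots> = (\<Sum>j\<in>I. \<Sum>i\<in>I. J j (\<lambda>q. \<rho> j q * h i q))" by (rule sum.swap)
  also have "\<dots> = (\<Sum>j\<in>I. J j (\<lambda>q. \<rho> j q * ?n))"
  proof (rule sum.cong[OF refl])
    fix j
    have "(\<Sum>i\<in>I. J j (\<lambda>q. \<rho> j q * h i q)) = J j (\<lambda>q. \<Sum>i\<in>I. \<rho> j q * h i q)"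
      by (rule J_sum[symmetric]) (auto intro!: continuous_intros c\<rho> h I simp: \<rho>)
    then show "(\<Sum>i\<in>I. J j (\<lambda>q. \<rho> j q * h i q)) = J j (\<lambda>q. \<rho> j q * ?n)"
      by (simp add: sum_h flip: sum_distrib_left)
  qed
  finally have sum0: "(\<Sum>j\<in>I. J j (\<lambda>q. \<rho> j q * ?n)) = 0" by simp
  have cn: "continuous_on UNIV (\<lambda>q. \<rho> j q * ?n)" for j by (intro continuous_intros c\<rho>)
  \<comment> \<open>A vanishing sum of nonnegative terms: each integral is 0, definiteness gives n
    \<rho>_j = 0, and as n > 0 this contradicts \<Sum>_j \<rho>_j = 1.\<close>
  have "J j (\<lambda>q. \<rho> j q * ?n) = 0" if "j \<in> I" for j
    using sum0 that I(1) J_pos(1)[OF cn] \<rho>(2,3) by (simp add: sum_nonneg_eq_0_iff)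
  then have "\<rho> j q * ?n = 0" if "j \<in> I" for j q
    using J_pos(2)[OF cn, of j j q] that \<rho>(2,3) by simp
  then have "\<rho> j q = 0" if "j \<in> I" for j q using that by simp
  then show False using sum_\<rho> by simp
qed

section \<open>Change of model space\<close>

text \<open>Change of variables is available only on \<open>real^'n\<close> with a well-ordered index type, so the
  model space \<open>'e\<close> is replaced by \<open>real^'e basis_index\<close>.\<close>

typedef (overloaded) ('e::euclidean_space) basis_index = "{..<DIM('e)}"
  using DIM_positive by (auto intro: exI[of _ 0])

instance basis_index :: (euclidean_space) finite
proof
  have "(UNIV :: 'a basis_index set) = Abs_basis_index ` {..<DIM('a)}"
    using type_definition.Abs_image[OF type_definition_basis_index] by metis
  then show "finite (UNIV :: 'a basis_index set)"
    by (metis finite_imageI finite_lessThan)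
qed

lemma CARD_basis_index: "CARD('e::euclidean_space basis_index) = DIM('e)"
  using type_definition.card[OF type_definition_basis_index] by simp

instantiation basis_index :: (euclidean_space) wellorder
begin

definition less_eq_basis_index :: "'a basis_index \<Rightarrow> 'a basis_index \<Rightarrow> bool" where
  "less_eq_basis_index i j \<longleftrightarrow> Rep_basis_index i \<le> Rep_basis_index j"

definition less_basis_index :: "'a basis_index \<Rightarrow> 'a basis_index \<Rightarrow> bool" where
  "less_basis_index i j \<longleftrightarrow> Rep_basis_index i < Rep_basis_index j"

instance
proof
  fix P :: "'a basis_index \<Rightarrow> bool" and i
  assume step: "\<And>i. (\<And>j. j < i \<Longrightarrow> P j) \<Longrightarrow> P i"
  show "P i"
    by (induction i rule: measure_induct_rule[of Rep_basis_index]) (auto intro: step simp: less_basis_index_def)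
qed (auto simp: less_eq_basis_index_def less_basis_index_def Rep_basis_index_inject)

end

lemma model_space_iso:
  obtains T :: "'e::euclidean_space \<Rightarrow> real^'e basis_index" and T' where
    "bounded_linear T" "bounded_linear T'" "\<And>v. T' (T v) = v" "\<And>y. T (T' y) = y"
proof -
  have "card (UNIV :: 'e basis_index set) = card (Basis :: 'e set)"
    by (rule CARD_basis_index)
  then obtain b :: "'e basis_index \<Rightarrow> 'e" where b: "bij_betw b UNIV Basis"
    using finite_same_card_bij[of "UNIV :: 'e basis_index set" "Basis :: 'e set"] by auto
  have bB: "b i \<in> Basis" for i using b by (auto simp: bij_betw_def)
  have inner: "b i \<bullet> b j = (if i = j then 1 else 0)" for i j
    using inner_Basis[OF bB bB] b by (auto simp: bij_betw_def inj_on_def)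
  let ?T = "\<lambda>v. (\<chi> i. v \<bullet> b i) :: real^'e basis_index"
  let ?T' = "\<lambda>y. \<Sum>i\<in>UNIV. (y $ i) *\<^sub>R b i"
  have "linear ?T" by (rule linearI) (auto simp: vec_eq_iff inner_add_left)
  moreover have "linear ?T'"
    by (rule linearI) (auto simp: scaleR_add_left sum.distrib scaleR_sum_right)
  moreover have "?T' (?T v) = v" for v
    using sum.reindex_bij_betw[OF b, of "\<lambda>b. (v \<bullet> b) *\<^sub>R b"] by (simp add: euclidean_representation)
  moreover have "?T (?T' y) = y" for y
    by (simp add: vec_eq_iff inner_sum_left inner if_distrib[of "\<lambda>t. _ * t"] cong: if_cong)
  ultimately show ?thesis
    using that[of ?T ?T'] by (simp add: linear_conv_bounded_linear)
qed

section \<open>Transport of the atlas along a linear isomorphism\<close>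

definition push_chart :: "('e \<Rightarrow> 'f) \<Rightarrow> ('m, 'e) chart \<Rightarrow> ('m, 'f) chart" where
  "push_chart T c = (fst c, T \<circ> snd c)"

locale linear_iso =
  fixes T :: "'e::euclidean_space \<Rightarrow> 'f::euclidean_space" and T'
  assumes T: "bounded_linear T" and T': "bounded_linear T'"
    and T'T [simp]: "\<And>v. T' (T v) = v" and TT' [simp]: "\<And>y. T (T' y) = y"
begin

lemma continuous: "continuous_on S T" "continuous_on R T'"
  using T T' by (auto intro: linear_continuous_on)

lemma image_eq_vimage: "T ` S = T' -` S"
proof
  show "T' -` S \<subseteq> T ` S" using TT' by (metis image_iff subsetI vimageE)
qed auto

lemma open_image: "open S \<Longrightarrow> open (T ` S)"
  unfolding image_eq_vimage by (rule open_vimage[OF _ continuous(2)])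

lemma smooth_on_pull: "open S \<Longrightarrow> smooth_on (T ` S) f \<Longrightarrow> smooth_on S (\<lambda>v. f (T v))"
  by (rule smooth_on_compose[OF _ open_image _ _ smooth_on_linear[OF T]]) (auto intro: smooth_on_ident)

lemma smooth_on_push: "open S \<Longrightarrow> smooth_on S f \<Longrightarrow> smooth_on (T ` S) (\<lambda>y. f (T' y))"
  by (rule smooth_on_compose[OF open_image _ _ _ smooth_on_linear[OF T' open_image]])
     (auto intro: smooth_on_ident open_image)

lemma inv_into_push:
  "inj_on \<phi> U \<Longrightarrow> y \<in> T ` \<phi> ` U \<Longrightarrow> inv_into U (T \<circ> \<phi>) y = inv_into U \<phi> (T' y)"
proof -
  assume inj: "inj_on \<phi> U" and "y \<in> T ` \<phi> ` U"
  then obtain q where q: "q \<in> U" "y = T (\<phi> q)" by auto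
  have "inj_on (T \<circ> \<phi>) U" using inj by (metis T'T comp_inj_on inj_on_inverseI)
  then show ?thesis using q inj by (metis T'T comp_apply inv_into_f_f)
qed

end

locale pushed_atlas = atlas_manifold A + linear_iso T T'
  for A :: "('m::{t2_space,second_countable_topology}, 'e::euclidean_space) chart set"
    and T :: "'e \<Rightarrow> 'f::euclidean_space" and T'
begin

abbreviation B :: "('m, 'f) chart set" where "B \<equiv> push_chart T ` A"

lemma B_iff: "(\<forall>c\<in>B. P c) \<longleftrightarrow> (\<forall>(U, \<phi>)\<in>A. P (U, T \<circ> \<phi>))"
  by (auto simp: push_chart_def)

text \<open>T and its inverse are linear, hence smooth, so composing charts with T changes no
  smoothness test. Tangent spaces and vector fields see the atlas only through its smooth functions
  and are thus literally the same for both atlases.\<close>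

lemma smooth_fun_B: "smooth_fun B = smooth_fun A"
proof
  fix f :: "'m \<Rightarrow> real"
  have "smooth_on ((T \<circ> \<phi>) ` U) (f \<circ> inv_into U (T \<circ> \<phi>)) \<longleftrightarrow> smooth_on (\<phi> ` U) (f \<circ> inv_into U \<phi>)"
    if c: "(U, \<phi>) \<in> A" for U \<phi>
  proof -
    note o = chart_facts(2)[OF c] and inv = inv_into_push[OF chart_facts(3)[OF c]]
    have eq: "f (inv_into U (T \<circ> \<phi>) y) = f (inv_into U \<phi> (T' y))" if "y \<in> T ` \<phi> ` U" for y
      using inv[OF that] by simp
    show ?thesis
    proof
      assume "smooth_on ((T \<circ> \<phi>) ` U) (f \<circ> inv_into U (T \<circ> \<phi>))"
      then have "smooth_on (T ` \<phi> ` U) (\<lambda>y. f (inv_into U (T \<circ> \<phi>) y))"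
        by (simp add: image_comp o_def)
      from smooth_on_pull[OF o this]
      show "smooth_on (\<phi> ` U) (f \<circ> inv_into U \<phi>)"
        by (rule smooth_on_cong[OF o, rotated]) (simp add: eq)
    next
      assume "smooth_on (\<phi> ` U) (f \<circ> inv_into U \<phi>)"
      then have "smooth_on (T ` \<phi> ` U) (\<lambda>y. (f \<circ> inv_into U \<phi>) (T' y))"
        by (rule smooth_on_push[OF o])
      then have "smooth_on (T ` \<phi> ` U) (\<lambda>y. f (inv_into U (T \<circ> \<phi>) y))"
        by (rule smooth_on_cong[OF open_image[OF o], rotated]) (simp add: eq)
      then show "smooth_on ((T \<circ> \<phi>) ` U) (f \<circ> inv_into U (T \<circ> \<phi>))"
        by (simp add: image_comp o_def)
    qed
  qed
  then show "smooth_fun B f = smooth_fun A f"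
    unfolding smooth_fun_def B_iff by auto
qed

lemma smooth_manifold_B: "smooth_manifold B"
  unfolding smooth_manifold_def B_iff
proof (intro conjI)
  show "\<forall>(U, \<phi>)\<in>A. is_chart (U, T \<circ> \<phi>)"
  proof clarify
    fix U \<phi> assume c: "(U, \<phi>) \<in> A"
    have "homeomorphism (\<phi> ` U) (T ` \<phi> ` U) T T'"
      by (auto simp: homeomorphism_def continuous image_image)
    from homeomorphism_compose[OF chart_facts(4)[OF c] this]
    have "homeomorphism U (T ` \<phi> ` U) (T \<circ> \<phi>) (inv_into U (T \<circ> \<phi>))"
      by (rule homeomorphism_cong) (auto simp: inv_into_push[OF chart_facts(3)[OF c]])
    then show "is_chart (U, T \<circ> \<phi>)"
      using chart_facts(1)[OF c] open_image[OF chart_facts(2)[OF c]]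
      by (simp add: is_chart_def image_comp)
  qed
  have "fst ` B = fst ` A" by (force simp: push_chart_def image_iff)
  then show "(\<Union>c\<in>B. fst c) = UNIV" using manifold by (simp add: smooth_manifold_def)
  show "connected (UNIV :: 'm set)" using manifold by (simp add: smooth_manifold_def)
  show "\<forall>(U, \<phi>)\<in>A. \<forall>(V, \<psi>)\<in>A. smooth_transition (U, T \<circ> \<phi>) (V, T \<circ> \<psi>)"
  proof clarify
    fix U \<phi> V \<psi> assume c: "(U, \<phi>) \<in> A" and d: "(V, \<psi>) \<in> A"
    let ?S = "\<phi> ` (U \<inter> V)"
    have o: "open ?S" by (rule open_chart_image[OF c]) (use chart_facts(1)[OF c] chart_facts(1)[OF d] in auto)
    have "smooth_on ?S (\<psi> \<circ> inv_into U \<phi>)"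
      using manifold c d by (auto simp: smooth_manifold_def smooth_transition_def)
    then have "smooth_on (T ` ?S) (\<lambda>y. T ((\<psi> \<circ> inv_into U \<phi>) (T' y)))"
      by (intro smooth_on_push o smooth_on_linear[OF T])
    then have "smooth_on (T ` ?S) ((T \<circ> \<psi>) \<circ> inv_into U (T \<circ> \<phi>))"
      by (rule smooth_on_cong[OF open_image[OF o], rotated]) (auto simp: inv_into_push[OF chart_facts(3)[OF c]])
    then show "smooth_transition (U, T \<circ> \<phi>) (V, T \<circ> \<psi>)"
      by (simp add: smooth_transition_def image_comp)
  qed
qed

lemma tangent_space_B: "tangent_space B = tangent_space A"
  unfolding tangent_space_def smooth_fun_B ..

lemma vector_fields_B: "vector_fields B = vector_fields A"
  unfolding vector_fields_def smooth_fun_B tangent_space_B ..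

text \<open>\<open>volume_form\<close> is not in this list since its definition mentions the
  dimension of the model space, for which \<open>CARD_basis_index\<close> is used in
  addition.\<close>

lemma structures_B:
  "radiant_structure B nabla E = radiant_structure A nabla E"
  "diff_form B k \<omega> = diff_form A k \<omega>"
  "parallel_form B nabla k \<omega> = parallel_form A nabla k \<omega>"
  "form_is_zero B k \<omega> = form_is_zero A k \<omega>"
  unfolding radiant_structure_def affine_connection_def torsion_free_def diff_form_def
    parallel_form_def form_is_zero_def smooth_fun_B tangent_space_B vector_fields_B
  by (rule refl)+

end

theorem lemma3p18:
  fixes A :: "('m::{t2_space,second_countable_topology}, 'e::euclidean_space) chart set"
    and nabla :: "'m vfield \<Rightarrow> 'm vfield \<Rightarrow> 'm vfield"
    and E :: "'m vfield"
  assumes "smooth_manifold A"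
    and "compact (UNIV :: 'm set)"
    and "radiant_structure A nabla E"
  shows "\<not> (\<exists>\<omega>. volume_form A \<omega> \<and> parallel_form A nabla DIM('e) \<omega>)
       \<and> (\<forall>\<alpha>. diff_form A 1 \<alpha> \<longrightarrow> parallel_form A nabla 1 \<alpha> \<longrightarrow> form_is_zero A 1 \<alpha>)"
proof -
  obtain T :: "'e \<Rightarrow> real^'e basis_index" and T' where
    "bounded_linear T" "bounded_linear T'" "\<And>v. T' (T v) = v" "\<And>y. T (T' y) = y"
    using model_space_iso by blast
  then interpret pushed_atlas A T T'
    using assms(1) by (simp add: pushed_atlas_def atlas_manifold_def linear_iso_def)
  have rad: "radiant_structure B nabla E" using assms(3) by (simp only: structures_B)
  have "\<not> (volume_form A \<omega> \<and> parallel_form A nabla DIM('e) \<omega>)" for \<omega>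
  proof
    assume "volume_form A \<omega> \<and> parallel_form A nabla DIM('e) \<omega>"
    then have "volume_form B \<omega>" "parallel_form B nabla CARD('e basis_index) \<omega>"
      by (simp_all add: volume_form_def structures_B tangent_space_B CARD_basis_index)
    then show False
      by (rule no_parallel_volume_form[OF smooth_manifold_B assms(2) rad])
  qed
  moreover have "form_is_zero A 1 \<alpha>" if "diff_form A 1 \<alpha>" "parallel_form A nabla 1 \<alpha>" for \<alpha>
    using parallel_one_form_zero[OF smooth_manifold_B assms(2) rad, of \<alpha>] that
    by (simp only: structures_B)
  ultimately show ?thesis by blast
qed

end
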